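(* Let $\mathcal{P}=(P,\leq^\mathcal{P})$ be a finite poset with coloring $\lambda:P\to\Lambda$ ($\Lambda$ finite), with a fixed chain partition $(C_1,\dots,C_w)$, and let $\phi$ be a first-order sentence in negation normal form. The existential player has a winning strategy in the $r$-local Hintikka game $\mathcal{G}_r(\mathcal{P},\phi)$ if and only if $\mathcal{P}\models\phi$.
   Context: $\mathcal{P}$ has width $w$ (maximum antichain size), and $(C_1,\dots,C_w)$ is a partition of $P$ into chains; for $p\in C_j$ write $C(p)=C_j$. Digraphs may have labeled vertices, labeled arcs and parallel arcs. For a digraph $D$, vertices $v_1,\dots,v_k$ and an integer $r$, $R^D_r(v_1,\dots,v_k)$ denotes the set of vertices reachable from some $v_i$ by a directed path of length at most $r$. Put $r_s=3\cdot 4^s-1$. Define inductively for $s\ge 0$ labelings $\tau_s$ of $P$ and digraphs $D_s$. Let $\tau_0(p)=\langle\lambda(p),j\rangle$ where $C(p)=C_j$. Given $\tau_s$, $D_s$ is the digraph with vertex set $P$, vertex labels $\tau_s$, and the following arcs: for every $p\in P$ and $j\in\{1,\dots,w\}$, an arc labeled 'max' from $p$ to the topmost element of $C_j$; an arc labeled 'min' from $p$ to the bottommost element of $C_j$; and for every value $t\in\{\tau_s(q):q\in C_j\}$, an arc labeled 'up' from $p$ to the bottommost element $p'\in C_j$ with $p'\neq p$, $\tau_s(p')=t$ and $p\leq^\mathcal{P} p'$ (if such exists), and an arc labeled 'down' from $p$ to the topmost element $p'\in C_j$ with $p'\ne p$, $\tau_s(p')=t$ and $p'\leq^\mathcal{P}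 p$ (if such exists). Let $P_s(p)=R^{D_s}_{r_s}(p)$ and let $\mathcal{A}_s(p)$ be the structure formed by the vertex- and arc-labeled induced subdigraph $D_s[P_s(p)]$ rooted at $p$, together with the relation $\leq^\mathcal{P}$ restricted to $P_s(p)$; $\tau_{s+1}(p)$ is the isomorphism type of $\mathcal{A}_s(p)$. First-order formulas use the binary relation $\leq^\mathcal{P}$ and unary color predicates $c(x)$ ($c\in\Lambda$); atoms are $x=y$, $x\leq^\mathcal{P}y$, $c(x)$; negation normal form means negations only in front of atoms. The Hintikka game $\mathcal{G}(\mathcal{P},\phi)$: positions are pairs $(\psi,\beta)$ where $\psi$ is a subformula of $\phi$ and $\beta$ assigns elements of $P$ to the free variables of $\psi$, written $\psi(p_1,\dots,p_\ell)$. The existential player moves from a disjunction to one of its disjuncts and from $\exists y.\psi'(p_1,\dots,p_i,y)$ to some $\psi'(p_1,\dots,p_i,p)$ with $p\in P$; the universal player moves analogously at conjunctions and universal quantifiers. At a (possibly negated) atom, the existential player wins iff it holds in $\mathcal{P}$. The $r$-local Hintikka game $\mathcal{G}_r(\mathcal{P},\phi)$ has the same positions and rules with one extra restriction: for $Q\in\{\exists,\forall\}$ and any position $Qy.\,\psi'(p_1,\dots,p_i,y)$ with $i\ge 1$, player $Q$ must move to $\psi'(p_1,\dots,p_i,p)$ with $p\in R^{D_q}_{r_q-r_{q-1}}(p_1,\dots,p_i)$, where $q\ge1$ is the quantifier rank of $\psi'$; if $\psi'$ is quantifier-free, the restriction is $p\in R^{D_0}_{r_0}(p_1,\dots,p_i)$.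 Moves from positions with $i=0$ are unrestricted. *)

theory Defs
  imports
    "HOL-Library.Disjoint_Sets"
    "Graph_Theory.Digraph_Component"
begin

section \<open>Posets\<close>

text \<open>A poset is a carrier set \<open>P\<close> with its order given as a relation \<open>leq\<close>;
  \<open>(p, q) \<in> leq\<close> means that \<open>p\<close> is below or equal to \<open>q\<close>.\<close>

definition antichain :: "'a rel \<Rightarrow> 'a set \<Rightarrow> bool" where
  "antichain leq A \<longleftrightarrow> (\<forall>x\<in>A. \<forall>y\<in>A. x \<noteq> y \<longrightarrow> (x, y) \<notin> leq)"

definition poset_width :: "'a set \<Rightarrow> 'a rel \<Rightarrow> nat" where
  "poset_width P leq = Max {card A |A. A \<subseteq> P \<and> antichain leq A}"

definition topmost :: "'a rel \<Rightarrow> 'a set \<Rightarrow> 'a \<Rightarrow> bool" where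
  "topmost leq S x \<longleftrightarrow> x \<in> S \<and> (\<forall>y\<in>S. (y, x) \<in> leq)"

definition bottommost :: "'a rel \<Rightarrow> 'a set \<Rightarrow> 'a \<Rightarrow> bool" where
  "bottommost leq S x \<longleftrightarrow> x \<in> S \<and> (\<forall>y\<in>S. (x, y) \<in> leq)"

section \<open>Labeled digraphs and their isomorphisms\<close>

datatype arc_label = Max_arc | Min_arc | Up_arc | Down_arc

text \<open>An arc is a triple (tail, label, head).  Parallel arcs with different labels are different
  triples; parallel arcs with equal labels do not occur in the digraphs considered here.\<close>

type_synonym 'a arc = "'a \<times> arc_label \<times> 'a"

definition reach_within :: "('a, 'b) pre_digraph \<Rightarrow> nat \<Rightarrow> 'a set \<Rightarrow> 'a set" where
  "reach_within D r S = {v. \<exists>u\<in>S. \<exists>\<pi>. pre_digraph.apath D u \<pi> v \<and> length \<pi> \<le> r}"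

record ('a, 'l) rooted_structure =
  graph :: "('a, 'a arc) pre_digraph"
  vertex_label :: "'a \<Rightarrow> 'l"
  root :: 'a
  order_rel :: "'a rel"

definition isomorphic :: "('a, 'l) rooted_structure \<Rightarrow> ('a, 'l) rooted_structure \<Rightarrow> bool" where
  "isomorphic A B \<longleftrightarrow> (\<exists>f.
     bij_betw f (verts (graph A)) (verts (graph B)) \<and>
     f (root A) = root B \<and>
     (\<forall>x\<in>verts (graph A). vertex_label B (f x) = vertex_label A x) \<and>
     (\<forall>x\<in>verts (graph A). \<forall>y\<in>verts (graph A). \<forall>l.
        (x, l, y) \<in> arcs (graph A) \<longleftrightarrow> (f x, l, f y) \<in> arcs (graph B)) \<and>
     (\<forall>x\<in>verts (graph A). \<forall>y\<in>verts (graph A).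
        (x, y) \<in> order_rel A \<longleftrightarrow> (f x, f y) \<in> order_rel B))"

text \<open>Values of the labelings: \<open>Base c j\<close> is a color together with the index of a chain.
  \<open>Iso_type Q\<close> stands for an isomorphism type of rooted structures, given by the set \<open>Q\<close> of
  all elements of the poset whose associated structure has this type.  Two elements hence get the
  same value iff their structures are isomorphic.\<close>

datatype ('a, 'c) label = Base 'c nat | Iso_type "'a set"

definition radius :: "nat \<Rightarrow> nat" where
  "radius s = 3 * 4 ^ s - 1"

section \<open>First-order formulas\<close>

datatype 'c formula =
    Eq nat nat
  | Leq nat nat
  | Col 'c nat
  | Neg "'c formula"
  | And "'c formula" "'c formula"
  | Or "'c formula" "'c formula"
  | Ex nat "'c formula"
  | All nat "'c formula"

primrec free_vars :: "'c formula \<Rightarrow> nat set" where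
  "free_vars (Eq x y) = {x, y}"
| "free_vars (Leq x y) = {x, y}"
| "free_vars (Col c x) = {x}"
| "free_vars (Neg \<psi>) = free_vars \<psi>"
| "free_vars (And \<psi> \<chi>) = free_vars \<psi> \<union> free_vars \<chi>"
| "free_vars (Or \<psi> \<chi>) = free_vars \<psi> \<union> free_vars \<chi>"
| "free_vars (Ex y \<psi>) = free_vars \<psi> - {y}"
| "free_vars (All y \<psi>) = free_vars \<psi> - {y}"

primrec colors_of :: "'c formula \<Rightarrow> 'c set" where
  "colors_of (Eq x y) = {}"
| "colors_of (Leq x y) = {}"
| "colors_of (Col c x) = {c}"
| "colors_of (Neg \<psi>) = colors_of \<psi>"
| "colors_of (And \<psi> \<chi>) = colors_of \<psi> \<union> colors_of \<chi>"
| "colors_of (Or \<psi> \<chi>) = colors_of \<psi> \<union> colors_of \<chi>"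
| "colors_of (Ex y \<psi>) = colors_of \<psi>"
| "colors_of (All y \<psi>) = colors_of \<psi>"

primrec quantifier_rank :: "'c formula \<Rightarrow> nat" where
  "quantifier_rank (Eq x y) = 0"
| "quantifier_rank (Leq x y) = 0"
| "quantifier_rank (Col c x) = 0"
| "quantifier_rank (Neg \<psi>) = quantifier_rank \<psi>"
| "quantifier_rank (And \<psi> \<chi>) = max (quantifier_rank \<psi>) (quantifier_rank \<chi>)"
| "quantifier_rank (Or \<psi> \<chi>) = max (quantifier_rank \<psi>) (quantifier_rank \<chi>)"
| "quantifier_rank (Ex y \<psi>) = Suc (quantifier_rank \<psi>)"
| "quantifier_rank (All y \<psi>) = Suc (quantifier_rank \<psi>)"

fun is_atom :: "'c formula \<Rightarrow> bool" where
  "is_atom (Eq x y) = True"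
| "is_atom (Leq x y) = True"
| "is_atom (Col c x) = True"
| "is_atom _ = False"

definition is_literal :: "'c formula \<Rightarrow> bool" where
  "is_literal \<psi> \<longleftrightarrow> is_atom \<psi> \<or> (\<exists>\<alpha>. is_atom \<alpha> \<and> \<psi> = Neg \<alpha>)"

primrec nnf :: "'c formula \<Rightarrow> bool" where
  "nnf (Eq x y) = True"
| "nnf (Leq x y) = True"
| "nnf (Col c x) = True"
| "nnf (Neg \<psi>) = is_atom \<psi>"
| "nnf (And \<psi> \<chi>) = (nnf \<psi> \<and> nnf \<chi>)"
| "nnf (Or \<psi> \<chi>) = (nnf \<psi> \<and> nnf \<chi>)"
| "nnf (Ex y \<psi>) = nnf \<psi>"
| "nnf (All y \<psi>) = nnf \<psi>"

text \<open>Assignments are partial maps; they are only ever used on formulas all of whose free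
  variables are assigned.\<close>

primrec sat :: "'a set \<Rightarrow> 'a rel \<Rightarrow> ('a \<Rightarrow> 'c) \<Rightarrow> (nat \<rightharpoonup> 'a) \<Rightarrow> 'c formula \<Rightarrow> bool" where
  "sat P leq col \<beta> (Eq x y) \<longleftrightarrow> the (\<beta> x) = the (\<beta> y)"
| "sat P leq col \<beta> (Leq x y) \<longleftrightarrow> (the (\<beta> x), the (\<beta> y)) \<in> leq"
| "sat P leq col \<beta> (Col c x) \<longleftrightarrow> col (the (\<beta> x)) = c"
| "sat P leq col \<beta> (Neg \<psi>) \<longleftrightarrow> \<not> sat P leq col \<beta> \<psi>"
| "sat P leq col \<beta> (And \<psi> \<chi>) \<longleftrightarrow> sat P leq col \<beta> \<psi> \<and> sat P leq col \<beta> \<chi>"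
| "sat P leq col \<beta> (Or \<psi> \<chi>) \<longleftrightarrow> sat P leq col \<beta> \<psi> \<or> sat P leq col \<beta> \<chi>"
| "sat P leq col \<beta> (Ex y \<psi>) \<longleftrightarrow> (\<exists>p\<in>P. sat P leq col (\<beta>(y \<mapsto> p)) \<psi>)"
| "sat P leq col \<beta> (All y \<psi>) \<longleftrightarrow> (\<forall>p\<in>P. sat P leq col (\<beta>(y \<mapsto> p)) \<psi>)"

definition models :: "'a set \<Rightarrow> 'a rel \<Rightarrow> ('a \<Rightarrow> 'c) \<Rightarrow> 'c formula \<Rightarrow> bool" where
  "models P leq col \<phi> \<longleftrightarrow> sat P leq col Map.empty \<phi>"

section \<open>Games and winning strategies\<close>

text \<open>\<open>turn_E\<close> are the positions at which the existential player moves, and \<open>won_E\<close> decides the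
  outcome at the positions without legal moves.  Only games without infinite plays are considered,
  so the value of infinite plays need not be specified.\<close>

record 'p game =
  start :: 'p
  moves :: "'p rel"
  turn_E :: "'p set"
  won_E :: "'p set"

definition plays :: "'p game \<Rightarrow> 'p list set" where
  "plays G = {\<pi>. \<pi> \<noteq> [] \<and> hd \<pi> = start G \<and> successively (\<lambda>x y. (x, y) \<in> moves G) \<pi>}"

text \<open>A strategy of the existential player maps the history of a (partial) play to the
  next position.\<close>

definition conforms :: "'p game \<Rightarrow> ('p list \<Rightarrow> 'p) \<Rightarrow> 'p list \<Rightarrow> bool" where
  "conforms G \<sigma> \<pi> \<longleftrightarrow>
     (\<forall>i. Suc i < length \<pi> \<longrightarrow> \<pi> ! i \<in> turn_E G \<longrightarrow> \<pi> ! Suc i = \<sigma> (take (Suc i) \<pi>))"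

definition winning_strategy_E :: "'p game \<Rightarrow> ('p list \<Rightarrow> 'p) \<Rightarrow> bool" where
  "winning_strategy_E G \<sigma> \<longleftrightarrow> (\<forall>\<pi>\<in>plays G. conforms G \<sigma> \<pi> \<longrightarrow>
     (if last \<pi> \<in> Domain (moves G)
      then last \<pi> \<in> turn_E G \<longrightarrow> (last \<pi>, \<sigma> \<pi>) \<in> moves G
      else last \<pi> \<in> won_E G))"

section \<open>Hintikka games\<close>

text \<open>The assignment of a position is defined exactly on the free variables of its formula.\<close>

type_synonym ('a, 'c) position = "'c formula \<times> (nat \<rightharpoonup> 'a)"

text \<open>In \<open>hintikka_moves choices\<close>, at a position \<open>(Q y. \<psi>, \<beta>)\<close> with a quantifier \<open>Q\<close> the variable
  \<open>y\<close> may be assigned any element of \<open>choices \<psi> \<beta>\<close>.\<close>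

inductive_set hintikka_moves ::
    "('c formula \<Rightarrow> (nat \<rightharpoonup> 'a) \<Rightarrow> 'a set) \<Rightarrow> ('a, 'c) position rel"
  for choices where
  And1: "((And \<psi> \<chi>, \<beta>), (\<psi>, \<beta> |` free_vars \<psi>)) \<in> hintikka_moves choices"
| And2: "((And \<psi> \<chi>, \<beta>), (\<chi>, \<beta> |` free_vars \<chi>)) \<in> hintikka_moves choices"
| Or1: "((Or \<psi> \<chi>, \<beta>), (\<psi>, \<beta> |` free_vars \<psi>)) \<in> hintikka_moves choices"
| Or2: "((Or \<psi> \<chi>, \<beta>), (\<chi>, \<beta> |` free_vars \<chi>)) \<in> hintikka_moves choices"
| Ex: "p \<in> choices \<psi> \<beta> \<Longrightarrow>
    ((Ex y \<psi>, \<beta>), (\<psi>, \<beta>(y \<mapsto> p) |` free_vars \<psi>)) \<in> hintikka_moves choices"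
| All: "p \<in> choices \<psi> \<beta> \<Longrightarrow>
    ((All y \<psi>, \<beta>), (\<psi>, \<beta>(y \<mapsto> p) |` free_vars \<psi>)) \<in> hintikka_moves choices"

text \<open>The second part of \<open>won_E\<close> only matters for the empty poset: a player who has to choose an
  element but cannot do so loses.\<close>

definition hintikka_game_with ::
    "('c formula \<Rightarrow> (nat \<rightharpoonup> 'a) \<Rightarrow> 'a set) \<Rightarrow> 'a set \<Rightarrow> 'a rel \<Rightarrow> ('a \<Rightarrow> 'c) \<Rightarrow> 'c formula
      \<Rightarrow> ('a, 'c) position game" where
  "hintikka_game_with choices P leq col \<phi> =
     \<lparr> start = (\<phi>, Map.empty),
       moves = hintikka_moves choices,
       turn_E = {(Or \<psi> \<chi>, \<beta>) |\<psi> \<chi> \<beta>. True} \<union> {(Ex y \<psi>, \<beta>) |y \<psi> \<beta>. True},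
       won_E = {(\<psi>, \<beta>). is_literal \<psi> \<and> sat P leq col \<beta> \<psi>} \<union> {(All y \<psi>, \<beta>) |y \<psi> \<beta>. True} \<rparr>"

definition hintikka_game :: "'a set \<Rightarrow> 'a rel \<Rightarrow> ('a \<Rightarrow> 'c) \<Rightarrow> 'c formula
      \<Rightarrow> ('a, 'c) position game" where
  "hintikka_game P leq col \<phi> = hintikka_game_with (\<lambda>\<psi> \<beta>. P) P leq col \<phi>"

section \<open>Colored posets with a chain partition\<close>

text \<open>The chains are \<open>C 1, \<dots>, C w\<close>.  They are nonempty because \<open>w\<close> is the width.\<close>

locale chain_partitioned_poset =
  fixes P :: "'a set"
    and leq :: "'a rel"
    and \<Lambda> :: "'c set"
    and col :: "'a \<Rightarrow> 'c"
    and w :: nat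
    and C :: "nat \<Rightarrow> 'a set"
  assumes finite_P: "finite P"
    and order: "partial_order_on P leq"
    and finite_colors: "finite \<Lambda>"
    and coloring: "col \<in> P \<rightarrow> \<Lambda>"
    and width: "w = poset_width P leq"
    and disjoint_chains: "disjoint_family_on C {1..w}"
    and cover: "(\<Union>j\<in>{1..w}. C j) = P"
    and chains: "\<And>j. j \<in> {1..w} \<Longrightarrow> C j \<in> Chains leq"
begin

definition chain_index :: "'a \<Rightarrow> nat" where
  "chain_index p = (THE j. j \<in> {1..w} \<and> p \<in> C j)"

definition digraph_of :: "('a \<Rightarrow> 'l) \<Rightarrow> ('a, 'a arc) pre_digraph" where
  "digraph_of \<tau> =
     \<lparr> verts = P,
       arcs =
         {(p, Max_arc, p') |p p' j. p \<in> P \<and> j \<in> {1..w} \<and> topmost leq (C j) p'} \<union>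
         {(p, Min_arc, p') |p p' j. p \<in> P \<and> j \<in> {1..w} \<and> bottommost leq (C j) p'} \<union>
         {(p, Up_arc, p') |p p' j t. p \<in> P \<and> j \<in> {1..w} \<and> t \<in> \<tau> ` C j \<and>
            bottommost leq {x \<in> C j. x \<noteq> p \<and> \<tau> x = t \<and> (p, x) \<in> leq} p'} \<union>
         {(p, Down_arc, p') |p p' j t. p \<in> P \<and> j \<in> {1..w} \<and> t \<in> \<tau> ` C j \<and>
            topmost leq {x \<in> C j. x \<noteq> p \<and> \<tau> x = t \<and> (x, p) \<in> leq} p'},
       tail = fst,
       head = snd \<circ> snd \<rparr>"

definition local_structure :: "nat \<Rightarrow> ('a \<Rightarrow> 'l) \<Rightarrow> 'a \<Rightarrow> ('a, 'l) rooted_structure" where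
  "local_structure s \<tau> p =
     (let N = reach_within (digraph_of \<tau>) (radius s) {p}
      in \<lparr> graph = digraph_of \<tau> \<restriction> N,
           vertex_label = \<tau>,
           root = p,
           order_rel = leq \<inter> N \<times> N \<rparr>)"

primrec labeling :: "nat \<Rightarrow> 'a \<Rightarrow> ('a, 'c) label" where
  "labeling 0 = (\<lambda>p. Base (col p) (chain_index p))"
| "labeling (Suc s) = (\<lambda>p. Iso_type
     {q \<in> P. isomorphic (local_structure s (labeling s) q) (local_structure s (labeling s) p)})"

definition D :: "nat \<Rightarrow> ('a, 'a arc) pre_digraph" where
  "D s = digraph_of (labeling s)"

text \<open>Here \<open>\<psi>\<close> is the formula below the quantifier; the elements \<open>p\<^sub>1, \<dots>, p\<^sub>i\<close> of a position form
  the range of its assignment.\<close>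

definition local_choices :: "'c formula \<Rightarrow> (nat \<rightharpoonup> 'a) \<Rightarrow> 'a set" where
  "local_choices \<psi> \<beta> =
     (let q = quantifier_rank \<psi> in
      if ran \<beta> = {} then P
      else if q = 0 then P \<inter> reach_within (D 0) (radius 0) (ran \<beta>)
      else P \<inter> reach_within (D q) (radius q - radius (q - 1)) (ran \<beta>))"

definition local_hintikka_game :: "'c formula \<Rightarrow> ('a, 'c) position game" where
  "local_hintikka_game \<phi> = hintikka_game_with local_choices P leq col \<phi>"

end

end

theory Submission
  imports Defs
begin

text \<open>Whether the offered choices suffice to decide a quantifier is a question about twins: given
  elements \<open>A\<close> of a position and an arbitrary \<open>p\<close>, one looks for a \<open>p'\<close> close to \<open>A\<close> in \<open>D (Suc s)\<close>
  that is indistinguishable from \<open>p\<close> over \<open>A\<close>.  Among the elements of the chain of \<open>p\<close> with the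
  same label, let \<open>p'\<close> be the one directly above the topmost one that is below \<open>p\<close> and close
  to \<open>A\<close>.  Equal labels mean that the neighbourhoods of \<open>p\<close> and \<open>p'\<close> in \<open>D s\<close> are isomorphic.  If
  some element \<open>x\<close> close to \<open>A\<close> compared differently with corresponding vertices \<open>q\<close> and \<open>q'\<close> of
  these neighbourhoods, then an arc from \<open>x\<close> would lead into the interval between \<open>q'\<close> and \<open>q\<close>, and
  walking back from there, always between the two walks, would produce an element close to \<open>A\<close>
  between \<open>p'\<close> and \<open>p\<close> with their label, contrary to the choice of \<open>p'\<close>.  Hence the isomorphism
  and the identity around \<open>A\<close> fit together, and a back-and-forth argument finishes the proof.\<close>

section \<open>Finite chains\<close>

lemma topmost_converse: "topmost (r\<inverse>) S = bottommost r S"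
  by (simp add: fun_eq_iff topmost_def bottommost_def)

lemma finite_chain_bottommost:
  assumes "finite S" "S \<noteq> {}" "trans r" "\<And>x y. x \<in> S \<Longrightarrow> y \<in> S \<Longrightarrow> (x, y) \<in> r \<or> (y, x) \<in> r"
  obtains b where "bottommost r S b"
proof -
  have "\<exists>b. bottommost r S b"
    using assms
  proof (induction S rule: finite_ne_induct)
    case (singleton x)
    then show ?case by (auto simp: bottommost_def)
  next
    case (insert x S)
    then obtain b where b: "bottommost r S b" by auto
    have "bottommost r (insert x S) b \<or> bottommost r (insert x S) x"
      using insert.prems(2)[of x x] insert.prems(2)[of x b] b transD[OF insert.prems(1)]
      unfolding bottommost_def by blast
    then show ?case by blast
  qed
  then show thesis using that by blast
qed

lemma finite_chain_topmost:
  assumes "finite S" "S \<noteq> {}" "trans r" "\<And>x y. x \<in> S \<Longrightarrow> y \<in> S \<Longrightarrow> (x, y) \<in> r \<or> (y, x) \<in> r"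
  obtains b where "topmost r S b"
proof (rule finite_chain_bottommost[of S "r\<inverse>"])
  show "\<And>x y. x \<in> S \<Longrightarrow> y \<in> S \<Longrightarrow> (x, y) \<in> r\<inverse> \<or> (y, x) \<in> r\<inverse>"
    using assms(4) by blast
  fix b
  assume "bottommost (r\<inverse>) S b"
  then show thesis
    using that topmost_converse[of "r\<inverse>" S] by simp
qed (use assms in auto)

context chain_partitioned_poset
begin

section \<open>The arcs of the digraphs\<close>

abbreviation le :: "'a \<Rightarrow> 'a \<Rightarrow> bool" (infix "\<sqsubseteq>" 50) where
  "x \<sqsubseteq> y \<equiv> (x, y) \<in> leq"

lemma le_in_P: "x \<sqsubseteq> y \<Longrightarrow> x \<in> P" "x \<sqsubseteq> y \<Longrightarrow> y \<in> P"
  using partial_order_onD(4)[OF order] by auto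

lemma le_refl: "x \<in> P \<Longrightarrow> x \<sqsubseteq> x"
  using partial_order_onD(1)[OF order] by (auto simp: refl_on_def)

lemma le_trans: "x \<sqsubseteq> y \<Longrightarrow> y \<sqsubseteq> z \<Longrightarrow> x \<sqsubseteq> z"
  using partial_order_onD(2)[OF order] by (rule transD)

lemma le_antisym: "x \<sqsubseteq> y \<Longrightarrow> y \<sqsubseteq> x \<Longrightarrow> x = y"
  using partial_order_onD(3)[OF order] by (rule antisymD)

lemma chain_subset: "j \<in> {1..w} \<Longrightarrow> C j \<subseteq> P"
  using cover by blast

lemma chain_index_eqI: "j \<in> {1..w} \<Longrightarrow> p \<in> C j \<Longrightarrow> chain_index p = j"
  using disjoint_chains unfolding chain_index_def disjoint_family_on_def by blast

lemma chain_index_mem: "p \<in> P \<Longrightarrow> chain_index p \<in> {1..w} \<and> p \<in> C (chain_index p)"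
  using cover chain_index_eqI by blast

section \<open>Refinement of the labels from level to level\<close>

lemma isomorphic_refl: "isomorphic A A"
  unfolding isomorphic_def by (rule exI[of _ id]) auto

text \<open>By reflexivity \<open>p\<close> lies in the set that is its own label, hence in the set
  belonging to \<open>q\<close>.\<close>

lemma labeling_Suc_eqD:
  assumes "labeling (Suc s) p = labeling (Suc s) q" "p \<in> P"
  shows "isomorphic (local_structure s (labeling s) p) (local_structure s (labeling s) q)"
  using assms isomorphic_refl by auto

declare labeling.simps(2) [simp del]

lemma vertex_in_reach_within: "p \<in> P \<Longrightarrow> p \<in> reach_within (digraph_of \<tau>) r {p}"
  by (auto simp: reach_within_def digraph_of_def pre_digraph.apath_def pre_digraph.awalk_def
      pre_digraph.cas.simps pre_digraph.awalk_verts.simps intro!: exI[of _ "[]"])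

text \<open>Isomorphisms map root to root and preserve vertex labels, and the structures compared at
  level \<open>Suc s\<close> carry the labels of level \<open>s\<close>.\<close>

lemma labeling_refines:
  assumes "labeling (Suc s) p = labeling (Suc s) q" "p \<in> P"
  shows "labeling s p = labeling s q"
  using labeling_Suc_eqD[OF assms] vertex_in_reach_within[OF assms(2)]
  by (force simp: isomorphic_def local_structure_def Let_def)

lemma labeling_refines_Base:
  assumes "labeling s p = labeling s q" "p \<in> P"
  shows "labeling 0 p = labeling 0 q"
  using assms(1)
proof (induction s)
  case (Suc s)
  then show ?case using labeling_refines[OF Suc.prems assms(2)] by blast
qed

text \<open>Every label determines the label of level 0, which records the index of the
  chain.\<close>

lemma same_chain:
  assumes "labeling s p = labeling s q" "p \<in> P" "q \<in> P" "j \<in> {1..w}"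
  shows "p \<in> C j \<longleftrightarrow> q \<in> C j"
proof -
  have "chain_index p = chain_index q"
    using labeling_refines_Base[OF assms(1,2)] by simp
  then show ?thesis
    using assms(2-) chain_index_mem chain_index_eqI by metis
qed

text \<open>A label class lies inside one chain and is therefore linearly ordered. This provides
  least and greatest members of classes in all later arguments.\<close>

lemma same_label_comparable:
  assumes "labeling s p = labeling s q" "p \<in> P" "q \<in> P"
  shows "p \<sqsubseteq> q \<or> q \<sqsubseteq> p"
proof -
  have "q \<in> C (chain_index p)"
    using same_chain[OF assms] chain_index_mem[OF assms(2)] by blast
  then show ?thesis
    using chains chain_index_mem[OF assms(2)] unfolding Chains_def by blast
qed

section \<open>Arcs in terms of the order on label classes\<close>

definition edge :: "nat \<Rightarrow> 'a \<Rightarrow> arc_label \<Rightarrow> 'a \<Rightarrow> bool" where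
  "edge s p l q \<longleftrightarrow> (p, l, q) \<in> arcs (D s)"

lemma edge_Max_iff: "edge s p Max_arc q \<longleftrightarrow> p \<in> P \<and> (\<exists>j\<in>{1..w}. topmost leq (C j) q)"
  unfolding edge_def D_def digraph_of_def by auto

lemma edge_Min_iff: "edge s p Min_arc q \<longleftrightarrow> p \<in> P \<and> (\<exists>j\<in>{1..w}. bottommost leq (C j) q)"
  unfolding edge_def D_def digraph_of_def by auto

text \<open>The label of the head already fixes its chain, so the index \<open>j\<close> and the
  value \<open>t\<close> disappear: minimality ranges over a whole label class.\<close>

lemma edge_Up_iff: "edge s p Up_arc q \<longleftrightarrow> p \<noteq> q \<and> p \<sqsubseteq> q \<and>
    (\<forall>x. labeling s x = labeling s q \<longrightarrow> x \<noteq> p \<longrightarrow> p \<sqsubseteq> x \<longrightarrow> q \<sqsubseteq> x)" (is "?L \<longleftrightarrow> ?R")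
proof
  assume ?L
  then obtain j where j: "j \<in> {1..w}" and
    q: "bottommost leq {x \<in> C j. x \<noteq> p \<and> labeling s x = labeling s q \<and> p \<sqsubseteq> x} q"
    unfolding edge_def D_def digraph_of_def by (auto simp: bottommost_def)
  have "x \<in> C j" if "labeling s x = labeling s q" "p \<sqsubseteq> x" for x
    using same_chain[OF that(1) _ _ j] le_in_P that q by (auto simp: bottommost_def)
  then show ?R using q by (auto simp: bottommost_def)
next
  assume R: ?R
  define j where "j = chain_index q"
  have j: "j \<in> {1..w}" "q \<in> C j"
    using R chain_index_mem[of q] le_in_P unfolding j_def by blast+
  then have "bottommost leq {x \<in> C j. x \<noteq> p \<and> labeling s x = labeling s q \<and> p \<sqsubseteq> x} q"
    using R by (auto simp: bottommost_def)
  then show ?L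
    using R j le_in_P unfolding edge_def D_def digraph_of_def by auto
qed

lemma edge_Down_iff: "edge s p Down_arc q \<longleftrightarrow> p \<noteq> q \<and> q \<sqsubseteq> p \<and>
    (\<forall>x. labeling s x = labeling s q \<longrightarrow> x \<noteq> p \<longrightarrow> x \<sqsubseteq> p \<longrightarrow> x \<sqsubseteq> q)" (is "?L \<longleftrightarrow> ?R")
proof
  assume ?L
  then obtain j where j: "j \<in> {1..w}" and
    q: "topmost leq {x \<in> C j. x \<noteq> p \<and> labeling s x = labeling s q \<and> x \<sqsubseteq> p} q"
    unfolding edge_def D_def digraph_of_def by (auto simp: topmost_def)
  have "x \<in> C j" if "labeling s x = labeling s q" "x \<sqsubseteq> p" for x
    using same_chain[OF that(1) _ _ j] le_in_P that q by (auto simp: topmost_def)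
  then show ?R using q by (auto simp: topmost_def)
next
  assume R: ?R
  define j where "j = chain_index q"
  have j: "j \<in> {1..w}" "q \<in> C j"
    using R chain_index_mem[of q] le_in_P unfolding j_def by blast+
  then have "topmost leq {x \<in> C j. x \<noteq> p \<and> labeling s x = labeling s q \<and> x \<sqsubseteq> p} q"
    using R by (auto simp: topmost_def)
  then show ?L
    using R j le_in_P unfolding edge_def D_def digraph_of_def by auto
qed

lemma edge_in_P: "edge s p l q \<Longrightarrow> p \<in> P" "edge s p l q \<Longrightarrow> q \<in> P"
proof -
  assume "edge s p l q"
  then have "p \<in> P \<and> q \<in> P"
    using chain_subset by (cases l)
      (auto simp: edge_Max_iff edge_Min_iff edge_Up_iff edge_Down_iff topmost_def bottommost_def
        dest: le_in_P)
  then show "p \<in> P" "q \<in> P" by auto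
qed

lemma topmost_same_label:
  assumes "i \<in> {1..w}" "topmost leq (C i) p" "j \<in> {1..w}" "topmost leq (C j) q"
    "labeling s p = labeling s q"
  shows "p = q"
  using same_chain[OF assms(5)] assms chain_subset le_antisym
  unfolding topmost_def by blast

lemma bottommost_same_label:
  assumes "i \<in> {1..w}" "bottommost leq (C i) p" "j \<in> {1..w}" "bottommost leq (C j) q"
    "labeling s p = labeling s q"
  shows "p = q"
  using same_chain[OF assms(5)] assms chain_subset le_antisym
  unfolding bottommost_def by blast

text \<open>The targets of these arcs do not depend on the tail, so even arcs from different tails
  can be compared, as the two sides of parallel walks require.\<close>

lemma edge_MaxMin_unique:
  assumes "edge s p l q" "edge s p' l q'" "labeling s q = labeling s q'" "l \<in> {Max_arc, Min_arc}"
  shows "q = q'"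
proof (cases "l = Max_arc")
  case True
  then show ?thesis
    using assms topmost_same_label[OF _ _ _ _ assms(3)] by (auto simp: edge_Max_iff)
next
  case False
  then show ?thesis
    using assms bottommost_same_label[OF _ _ _ _ assms(3)] by (auto simp: edge_Min_iff)
qed

text \<open>Arc label and label of the head together act as an address, so a walk is determined by
  its start and its sequence of addresses.\<close>

lemma edge_unique:
  assumes "edge s p l q" "edge s p l q'" "labeling s q = labeling s q'"
  shows "q = q'"
proof (cases l)
  case Up_arc
  with assms show ?thesis using le_antisym[of q q'] by (auto simp: edge_Up_iff)
next
  case Down_arc
  with assms show ?thesis using le_antisym[of q q'] by (auto simp: edge_Down_iff)
qed (use assms edge_MaxMin_unique in blast)+

text \<open>The arc into the class of \<open>x\<close> cannot overshoot \<open>x\<close>, because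
  \<open>x\<close> itself competes for being the least member. Most walks into a given interval are
  built from this lemma and its dual.\<close>

lemma edge_Up_exists:
  assumes "p \<sqsubseteq> x" "x \<noteq> p"
  shows "\<exists>q. edge s p Up_arc q \<and> labeling s q = labeling s x \<and> q \<sqsubseteq> x"
proof -
  let ?S = "{y. labeling s y = labeling s x \<and> y \<noteq> p \<and> p \<sqsubseteq> y}"
  have "finite ?S" by (rule finite_subset[OF _ finite_P]) (auto dest: le_in_P)
  moreover have "?S \<noteq> {}" using assms by blast
  moreover have "y \<sqsubseteq> z \<or> z \<sqsubseteq> y" if "y \<in> ?S" "z \<in> ?S" for y z
    using same_label_comparable[of s y z] that le_in_P by auto
  ultimately obtain b where "bottommost leq ?S b"
    using finite_chain_bottommost[of ?S leq] partial_order_onD(2)[OF order] by meson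
  then show ?thesis
    using assms by (intro exI[of _ b]) (auto simp: edge_Up_iff bottommost_def)
qed

lemma edge_Down_exists:
  assumes "x \<sqsubseteq> p" "x \<noteq> p"
  shows "\<exists>q. edge s p Down_arc q \<and> labeling s q = labeling s x \<and> x \<sqsubseteq> q"
proof -
  let ?S = "{y. labeling s y = labeling s x \<and> y \<noteq> p \<and> y \<sqsubseteq> p}"
  have "finite ?S" by (rule finite_subset[OF _ finite_P]) (auto dest: le_in_P)
  moreover have "?S \<noteq> {}" using assms by blast
  moreover have "y \<sqsubseteq> z \<or> z \<sqsubseteq> y" if "y \<in> ?S" "z \<in> ?S" for y z
    using same_label_comparable[of s y z] that le_in_P by auto
  ultimately obtain b where "topmost leq ?S b"
    using finite_chain_topmost[of ?S leq] partial_order_onD(2)[OF order] by meson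
  then show ?thesis
    using assms by (intro exI[of _ b]) (auto simp: edge_Down_iff topmost_def)
qed

lemma edge_Min_exists:
  assumes "p \<in> P" "x \<in> P"
  shows "\<exists>q. edge s p Min_arc q \<and> q \<sqsubseteq> x"
proof -
  let ?S = "C (chain_index x)"
  have j: "chain_index x \<in> {1..w}" "x \<in> ?S"
    using chain_index_mem[OF assms(2)] by auto
  moreover have "finite ?S" using finite_subset[OF chain_subset[OF j(1)] finite_P] .
  moreover have "y \<sqsubseteq> z \<or> z \<sqsubseteq> y" if "y \<in> ?S" "z \<in> ?S" for y z
    using chains[OF j(1)] that unfolding Chains_def by auto
  ultimately obtain b where "bottommost leq ?S b"
    using finite_chain_bottommost[of ?S leq] partial_order_onD(2)[OF order] by (metis empty_iff)
  then show ?thesis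
    using assms(1) j by (intro exI[of _ b]) (auto simp: edge_Min_iff bottommost_def)
qed

text \<open>Refining the labels shrinks the classes, and an extreme member of a class stays extreme
  in every smaller class that contains it.\<close>

lemma edge_Suc: "edge s p l q \<Longrightarrow> edge (Suc s) p l q"
  by (cases l) (auto simp: edge_Max_iff edge_Min_iff edge_Up_iff edge_Down_iff
      dest: labeling_refines le_in_P)

section \<open>Reachability\<close>

primrec reach :: "nat \<Rightarrow> 'a set \<Rightarrow> nat \<Rightarrow> 'a set" where
  "reach s A 0 = A"
| "reach s A (Suc k) = reach s A k \<union> {q. \<exists>p\<in>reach s A k. \<exists>l. edge s p l q}"

lemma reach_mono: "k \<le> m \<Longrightarrow> reach s A k \<subseteq> reach s A m"
  by (rule lift_Suc_mono_le) auto

lemma reach_edge: "p \<in> reach s A k \<Longrightarrow> edge s p l q \<Longrightarrow> k < m \<Longrightarrow> q \<in> reach s A m"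
  using reach_mono[of "Suc k" m s A] by auto

lemma reach_subset_P: "A \<subseteq> P \<Longrightarrow> reach s A k \<subseteq> P"
  by (induction k) (auto dest: edge_in_P)

lemma reach_Suc_level: "reach s A k \<subseteq> reach (Suc s) A k"
  by (induction k) (auto dest: edge_Suc)

lemma wf_digraph_D: "wf_digraph (D s)"
proof (rule wf_digraph.intro)
  have ends: "tail (D s) = fst" "head (D s) = snd \<circ> snd" "verts (D s) = P"
    by (simp_all add: D_def digraph_of_def)
  show "tail (D s) e \<in> verts (D s)" "head (D s) e \<in> verts (D s)" if "e \<in> arcs (D s)" for e
    using that edge_in_P[of s "fst e" "fst (snd e)" "snd (snd e)"] ends by (auto simp: edge_def)
qed

text \<open>Walks counted by \<open>reach\<close> may repeat vertices, whereas
  \<open>reach_within\<close> asks for paths. Removing cycles never lengthens a walk, so both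
  describe the same set.\<close>

lemma reach_within_D:
  assumes "A \<subseteq> P"
  shows "reach_within (D s) k A = reach s A k"
proof -
  interpret wf_digraph "D s" by (rule wf_digraph_D)
  have ends: "tail (D s) = fst" "head (D s) = snd \<circ> snd" "verts (D s) = P"
    by (simp_all add: D_def digraph_of_def)
  have walk: "v \<in> reach s A k \<longleftrightarrow> (\<exists>u\<in>A. \<exists>\<pi>. awalk u \<pi> v \<and> length \<pi> \<le> k)" for v
  proof (induction k arbitrary: v)
    case 0
    then show ?case using assms ends by (auto simp: awalk_Nil_iff)
  next
    case (Suc k)
    show ?case
    proof
      assume "v \<in> reach s A (Suc k)"
      then consider "v \<in> reach s A k" | p l where "p \<in> reach s A k" "edge s p l v" by auto
      then show "\<exists>u\<in>A. \<exists>\<pi>. awalk u \<pi> v \<and> length \<pi> \<le> Suc k"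
      proof cases
        case 1
        then show ?thesis using Suc.IH le_Suc_eq by blast
      next
        case 2
        then obtain u \<pi> where "u \<in> A" "awalk u \<pi> p" "length \<pi> \<le> k" using Suc.IH by blast
        moreover have "awalk p [(p, l, v)] v"
          using 2(2) edge_in_P[OF 2(2)] ends
          by (auto simp: awalk_def edge_def)
        ultimately show ?thesis
          by (intro bexI[of _ u] exI[of _ "\<pi> @ [(p, l, v)]"]) auto
      qed
    next
      assume "\<exists>u\<in>A. \<exists>\<pi>. awalk u \<pi> v \<and> length \<pi> \<le> Suc k"
      then obtain u \<pi> where u: "u \<in> A" "awalk u \<pi> v" "length \<pi> \<le> Suc k" by blast
      show "v \<in> reach s A (Suc k)"
      proof (cases \<pi> rule: rev_cases)
        case Nil
        with u have "v \<in> reach s A k"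
          unfolding Suc.IH by (intro bexI[of _ u] exI[of _ \<pi>]) auto
        then show ?thesis by simp
      next
        case (snoc \<pi>' e)
        then have "awalk u \<pi>' (fst e)" "awalk (fst e) [e] v"
          using u(2) ends by (auto simp: awalk_append_iff awalk_simps)
        moreover from this(2) have "edge s (fst e) (fst (snd e)) v"
          using ends by (auto simp: awalk_simps edge_def)
        ultimately show ?thesis
          using Suc.IH[of "fst e"] u snoc by auto
      qed
    qed
  qed
  have "\<exists>\<pi>'. apath u \<pi>' v \<and> length \<pi>' \<le> length \<pi>" if "awalk u \<pi> v" for u \<pi> v
    using that
  proof (induction rule: awalk_to_apath_induct)
    case (path p)
    then show ?case by (auto simp: apath_def)
  next
    case (decomp p q r t)
    have "p = q @ r @ t"
      using awalk_cyc_decomp_has_prop[OF decomp(1,3)] decomp(2) by auto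
    then show ?case using decomp(4) by fastforce
  qed
  then have eq: "(\<exists>\<pi>. apath u \<pi> v \<and> length \<pi> \<le> k) \<longleftrightarrow> (\<exists>\<pi>. awalk u \<pi> v \<and> length \<pi> \<le> k)" for u v
    using awalkI_apath order.trans by meson
  then show ?thesis
    by (simp only: reach_within_def set_eq_iff mem_Collect_eq walk eq simp_thms)
qed

section \<open>Parallel walks and local similarity\<close>

text \<open>Instead of isomorphisms between induced subdigraphs we compare tuples, given as sets of pairs,
  by following walks that start at both components and use the same arc labels and heads with the
  same vertex label.  Unlike the isomorphisms, this notion can be passed on to smaller levels and
  radii without having to look at the arcs between vertices on the boundary of the
  neighbourhoods.\<close>

primrec par :: "nat \<Rightarrow> 'a rel \<Rightarrow> nat \<Rightarrow> 'a rel" where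
  "par s S 0 = S"
| "par s S (Suc k) = par s S k \<union> {(q, q'). \<exists>p p' l. (p, p') \<in> par s S k \<and>
     edge s p l q \<and> edge s p' l q' \<and> labeling s q = labeling s q'}"

lemma par_SucE:
  assumes "(q, q') \<in> par s S (Suc k)"
  obtains (old) "(q, q') \<in> par s S k"
  | (step) p p' l where "(p, p') \<in> par s S k" "edge s p l q" "edge s p' l q'"
      "labeling s q = labeling s q'"
  using assms by auto

lemma par_le: "k \<le> m \<Longrightarrow> par s S k \<subseteq> par s S m"
  by (rule lift_Suc_mono_le[of "par s S"]) auto

lemma par_SucI:
  assumes "(p, p') \<in> par s S k" "edge s p l q" "edge s p' l q'" "labeling s q = labeling s q'"
    "k < m"
  shows "(q, q') \<in> par s S m"
proof -
  have "par s S (Suc k) \<subseteq> par s S m"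
    using assms(5) by (intro par_le) simp
  moreover have "(q, q') \<in> par s S (Suc k)"
    using assms(1-4) unfolding par.simps by blast
  ultimately show ?thesis by blast
qed

lemma par_mono: "S \<subseteq> T \<Longrightarrow> par s S k \<subseteq> par s T k"
  by (induction k) auto

text \<open>Each step prolongs a single pair, so walks from \<open>S\<close> and from
  \<open>T\<close> do not interact. In \<open>sim\<close>, a union thus adds only order comparisons
  across the two relations.\<close>

lemma par_Un: "par s (S \<union> T) k = par s S k \<union> par s T k"
  by (induction k) auto

lemma par_converse: "par s (S\<inverse>) k = (par s S k)\<inverse>"
  by (induction k) (simp_all, fastforce)

lemma par_add: "par s (par s S k) m = par s S (k + m)"
  by (induction m) auto

lemma par_in_P: "S \<subseteq> P \<times> P \<Longrightarrow> par s S k \<subseteq> P \<times> P"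
  by (induction k) (auto dest: edge_in_P)

lemma par_same_label:
  "(\<And>a a'. (a, a') \<in> S \<Longrightarrow> labeling s a = labeling s a') \<Longrightarrow> (b, b') \<in> par s S k \<Longrightarrow>
    labeling s b = labeling s b'"
  by (induction k arbitrary: b b') auto

text \<open>Two copies of one vertex that follow the same address stay together by
  \<open>edge_unique\<close>.\<close>

lemma par_Id_on: "(b, b') \<in> par s (Id_on A) k \<Longrightarrow> b = b' \<and> b \<in> reach s A k"
proof (induction k arbitrary: b b')
  case (Suc k)
  from Suc.prems show ?case
  proof (cases rule: par_SucE)
    case (step p p' l)
    then show ?thesis using Suc.IH[of p p'] edge_unique[of s p l b b'] by auto
  qed (use Suc.IH in auto)
qed auto

text \<open>The strict bound \<open>k < r\<close> keeps the head of a copied arc within radius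
  \<open>r\<close>, where \<open>sim\<close> compares the order.\<close>

definition forth :: "nat \<Rightarrow> nat \<Rightarrow> 'a rel \<Rightarrow> bool" where
  "forth s r S \<longleftrightarrow> (\<forall>k<r. \<forall>a a' l b. (a, a') \<in> par s S k \<longrightarrow> edge s a l b \<longrightarrow>
     (\<exists>b'. edge s a' l b' \<and> labeling s b = labeling s b'))"

text \<open>A local form of partial isomorphism. Labels are required on \<open>S\<close> only
  because the steps of \<open>par\<close> preserve them; the two uses of \<open>forth\<close> allow
  copying in both directions.\<close>

definition sim :: "nat \<Rightarrow> nat \<Rightarrow> 'a rel \<Rightarrow> bool" where
  "sim s r S \<longleftrightarrow> S \<subseteq> P \<times> P \<and> (\<forall>a a'. (a, a') \<in> S \<longrightarrow> labeling s a = labeling s a') \<and>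
     (\<forall>a a' b b'. (a, a') \<in> par s S r \<longrightarrow> (b, b') \<in> par s S r \<longrightarrow> (a \<sqsubseteq> b \<longleftrightarrow> a' \<sqsubseteq> b')) \<and>
     forth s r S \<and> forth s r (S\<inverse>)"

lemma forthD:
  assumes "forth s r S" "(a, a') \<in> par s S k" "k < r" "edge s a l b"
  obtains b' where "edge s a' l b'" "labeling s b = labeling s b'"
  using assms unfolding forth_def by blast

lemma simD:
  assumes "sim s r S"
  shows "S \<subseteq> P \<times> P" "(a, a') \<in> S \<Longrightarrow> labeling s a = labeling s a'"
    "(a, a') \<in> par s S r \<Longrightarrow> (b, b') \<in> par s S r \<Longrightarrow> a \<sqsubseteq> b \<longleftrightarrow> a' \<sqsubseteq> b'"
    "forth s r S" "forth s r (S\<inverse>)"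
  using assms unfolding sim_def by blast+

lemma forth_Un: "forth s r S \<Longrightarrow> forth s r T \<Longrightarrow> forth s r (S \<union> T)"
  unfolding forth_def par_Un by blast

lemma forth_subset: "forth s r T \<Longrightarrow> S \<subseteq> T \<Longrightarrow> forth s r S"
  unfolding forth_def using par_mono by blast

lemma forth_shift: "forth s (k + r) S \<Longrightarrow> forth s r (par s S k)"
  unfolding forth_def par_add by (meson nat_add_left_cancel_less)

lemma sim_subset:
  assumes "sim s r T" "S \<subseteq> T"
  shows "sim s r S"
proof -
  have "S\<inverse> \<subseteq> T\<inverse>" using assms(2) by blast
  then show ?thesis
    using assms forth_subset par_mono[OF assms(2)] unfolding sim_def by (meson subsetD subset_trans)
qed

lemma sim_converse: "sim s r S \<Longrightarrow> sim s r (S\<inverse>)"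
  unfolding sim_def par_converse by auto

lemma sim_shift:
  assumes "sim s (k + r) S"
  shows "sim s r (par s S k)"
  unfolding sim_def
proof (intro conjI allI impI)
  show "par s S k \<subseteq> P \<times> P" using simD(1)[OF assms] by (rule par_in_P)
  show "labeling s a = labeling s a'" if "(a, a') \<in> par s S k" for a a'
    using par_same_label simD(2)[OF assms] that by blast
  show "a \<sqsubseteq> b \<longleftrightarrow> a' \<sqsubseteq> b'" if "(a, a') \<in> par s (par s S k) r" "(b, b') \<in> par s (par s S k) r"
    for a a' b b'
    using simD(3)[OF assms] that unfolding par_add by blast
  show "forth s r (par s S k)" using forth_shift simD(4)[OF assms] by blast
  show "forth s r ((par s S k)\<inverse>)"
    using forth_shift simD(5)[OF assms] unfolding par_converse[symmetric] by blast
qed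

text \<open>Part \<open>k\<close> of the radius is spent on walking to the pair \<open>c\<close>. In
  this way a matched choice joins the tuple.\<close>

lemma sim_insert_par:
  assumes "sim s (k + r) S" "c \<in> par s S k"
  shows "sim s r (insert c S)"
  using sim_subset[OF sim_shift[OF assms(1)]] assms(2) par_le[of 0 k s S] by auto

text \<open>The copy of an arc of level \<open>s\<close> is at first only an arc of level
  \<open>Suc s\<close>, that is, extreme in a smaller class. A competitor in the larger class yields
  an arc from \<open>a'\<close> that can be copied back to \<open>a\<close>, where it loses against
  \<open>b\<close>; the order comparison carries this over to \<open>b'\<close>.\<close>

lemma forth_edge_lower:
  assumes sim: "sim (Suc s) r S" and k: "k < r" and a: "(a, a') \<in> par (Suc s) S k"
    and b: "edge s a l b" and b': "edge (Suc s) a' l b'" "labeling (Suc s) b = labeling (Suc s) b'"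
  shows "edge s a' l b'"
proof -
  have bb: "(b, b') \<in> par (Suc s) S r"
    using par_SucI[OF a edge_Suc[OF b] b' k] .
  have label: "labeling s b = labeling s b'"
    using labeling_refines[OF b'(2)] edge_in_P[OF b] by blast
  show ?thesis
  proof (cases l)
    case Up_arc
    have "b' \<sqsubseteq> x" if x: "labeling s x = labeling s b'" "x \<noteq> a'" "a' \<sqsubseteq> x" for x
    proof -
      \<comment> \<open>The competitor \<open>x\<close> need not be the head of an arc from
        \<open>a'\<close>. The least competitor \<open>c'\<close> is one, and bounding it from below
        also bounds \<open>x\<close>.\<close>
      obtain c' where c': "edge s a' Up_arc c'" "labeling s c' = labeling s x" "c' \<sqsubseteq> x"
        using edge_Up_exists[OF x(3,2)] by blast
      obtain c where c: "edge (Suc s) a Up_arc c" "labeling (Suc s) c' = labeling (Suc s) c"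
        using forthD[OF simD(5)[OF sim] _ k edge_Suc[OF c'(1)]] a by (auto simp: par_converse)
      have "labeling s c = labeling s b"
        using labeling_refines[OF c(2)] c'(2) x(1) label edge_in_P[OF c'(1)] by simp
      then have "b \<sqsubseteq> c" using b[unfolded Up_arc edge_Up_iff] c(1)[unfolded edge_Up_iff] by blast
      moreover have "(c, c') \<in> par (Suc s) S r"
        using par_SucI[OF a c(1) edge_Suc[OF c'(1)] c(2)[symmetric] k] .
      ultimately show ?thesis using simD(3)[OF sim bb] c'(3) le_trans by blast
    qed
    then show ?thesis using b'(1) Up_arc by (auto simp: edge_Up_iff)
  next
    case Down_arc
    have "x \<sqsubseteq> b'" if x: "labeling s x = labeling s b'" "x \<noteq> a'" "x \<sqsubseteq> a'" for x
    proof -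
      obtain c' where c': "edge s a' Down_arc c'" "labeling s c' = labeling s x" "x \<sqsubseteq> c'"
        using edge_Down_exists[OF x(3,2)] by blast
      obtain c where c: "edge (Suc s) a Down_arc c" "labeling (Suc s) c' = labeling (Suc s) c"
        using forthD[OF simD(5)[OF sim] _ k edge_Suc[OF c'(1)]] a by (auto simp: par_converse)
      have "labeling s c = labeling s b"
        using labeling_refines[OF c(2)] c'(2) x(1) label edge_in_P[OF c'(1)] by simp
      then have "c \<sqsubseteq> b" using b[unfolded Down_arc edge_Down_iff] c(1)[unfolded edge_Down_iff] by blast
      moreover have "(c, c') \<in> par (Suc s) S r"
        using par_SucI[OF a c(1) edge_Suc[OF c'(1)] c(2)[symmetric] k] .
      ultimately show ?thesis using simD(3)[OF sim _ bb] c'(3) le_trans by blast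
    qed
    then show ?thesis using b'(1) Down_arc by (auto simp: edge_Down_iff)
  qed (use b' in \<open>simp_all add: edge_Max_iff edge_Min_iff\<close>)
qed

text \<open>A parallel step at level \<open>s\<close> matches only the coarser labels. The copy of
  its left arc at level \<open>Suc s\<close> is by \<open>forth_edge_lower\<close> also an arc of
  level \<open>s\<close> with the same address, so \<open>edge_unique\<close> identifies it with the
  right arc.\<close>

lemma par_lower:
  assumes sim: "sim (Suc s) r S" and "k \<le> r"
  shows "par s S k \<subseteq> par (Suc s) S k"
  using assms(2)
proof (induction k)
  case (Suc k)
  show ?case
  proof (rule subrelI)
    fix b b' assume "(b, b') \<in> par s S (Suc k)"
    then show "(b, b') \<in> par (Suc s) S (Suc k)"
    proof (cases rule: par_SucE)
      case old
      then show ?thesis using Suc.IH Suc.prems by auto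
    next
      case (step a a' l)
      then have a: "(a, a') \<in> par (Suc s) S k" and k: "k < r"
        using Suc.IH Suc.prems by auto
      obtain c' where c': "edge (Suc s) a' l c'" "labeling (Suc s) b = labeling (Suc s) c'"
        using forthD[OF simD(4)[OF sim] a k edge_Suc[OF step(2)]] by blast
      have "labeling s b = labeling s c'"
        using labeling_refines[OF c'(2)] edge_in_P[OF step(2)] by blast
      then have "b' = c'"
        using edge_unique[OF step(3) forth_edge_lower[OF sim k a step(2) c']] step(4) by simp
      then show ?thesis using par_SucI[OF a edge_Suc[OF step(2)] c' lessI] by simp
    qed
  qed
qed simp

lemma forth_lower:
  assumes sim: "sim (Suc s) r S"
  shows "forth s r S"
  unfolding forth_def
proof (intro allI impI)
  fix k a a' l b
  assume k: "k < r" and a: "(a, a') \<in> par s S k" and b: "edge s a l b"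
  have a': "(a, a') \<in> par (Suc s) S k" using par_lower[OF sim less_imp_le[OF k]] a by blast
  obtain b' where b': "edge (Suc s) a' l b'" "labeling (Suc s) b = labeling (Suc s) b'"
    using forthD[OF simD(4)[OF sim] a' k edge_Suc[OF b]] by blast
  show "\<exists>b'. edge s a' l b' \<and> labeling s b = labeling s b'"
    using forth_edge_lower[OF sim k a' b b'] labeling_refines[OF b'(2)] edge_in_P[OF b] by blast
qed

lemma sim_lower:
  assumes sim: "sim (Suc s) r S"
  shows "sim s r S"
  unfolding sim_def
proof (intro conjI allI impI)
  show "S \<subseteq> P \<times> P" using simD(1)[OF sim] .
  then show "labeling s a = labeling s a'" if "(a, a') \<in> S" for a a'
    using labeling_refines simD(2)[OF sim that] that by blast
  show "a \<sqsubseteq> b \<longleftrightarrow> a' \<sqsubseteq> b'" if "(a, a') \<in> par s S r" "(b, b') \<in> par s S r" for a a' b b'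
    using simD(3)[OF sim] par_lower[OF sim order.refl] that by blast
  show "forth s r S" using forth_lower[OF sim] .
  show "forth s r (S\<inverse>)" using forth_lower[OF sim_converse[OF sim]] .
qed

lemma sim_Id_on:
  assumes "A \<subseteq> P"
  shows "sim s r (Id_on A)"
proof -
  have "forth s r (Id_on A)" unfolding forth_def using par_Id_on by blast
  moreover have "(Id_on A)\<inverse> = Id_on A" by auto
  moreover have "a \<sqsubseteq> b \<longleftrightarrow> a' \<sqsubseteq> b'"
    if "(a, a') \<in> par s (Id_on A) r" "(b, b') \<in> par s (Id_on A) r" for a a' b b'
    using par_Id_on[OF that(1)] par_Id_on[OF that(2)] by simp
  ultimately show ?thesis
    unfolding sim_def using assms by auto
qed

lemma reach_imp_par:
  assumes "sim s r S" "k \<le> r" "b \<in> reach s (Domain S) k"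
  shows "\<exists>b'. (b, b') \<in> par s S k"
  using assms(2,3)
proof (induction k arbitrary: b)
  case (Suc k)
  then consider "b \<in> reach s (Domain S) k" | a l where "a \<in> reach s (Domain S) k" "edge s a l b"
    by auto
  then show ?case
  proof cases
    case 1
    then show ?thesis using Suc.IH[of b] Suc.prems by auto
  next
    case 2
    then obtain a' where a': "(a, a') \<in> par s S k" using Suc.IH[of a] Suc.prems by auto
    obtain b' where "edge s a' l b'" "labeling s b = labeling s b'"
      using forthD[OF simD(4)[OF assms(1)] a' _ 2(2)] Suc.prems by auto
    then show ?thesis using par_SucI[OF a' 2(2) _ _ lessI] by blast
  qed
qed auto

text \<open>Parallel walks from \<open>p\<close> and \<open>p'\<close> follow the isomorphism
  \<open>f\<close>: the image of an arc has the same address as the arc chosen on the right, so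
  \<open>edge_unique\<close> equates their heads. All heads met within the radius lie in the induced
  subdigraph, where \<open>f\<close> preserves arcs and order.\<close>

lemma sim_of_same_label:
  assumes "labeling (Suc s) p = labeling (Suc s) p'" "p \<in> P" "p' \<in> P"
  shows "sim s (radius s) {(p, p')}"
proof -
  let ?r = "radius s" and ?t = "labeling s"
  let ?N = "reach s {p} ?r" and ?N' = "reach s {p'} ?r"
  have str: "graph (local_structure s ?t q) = D s \<restriction> reach s {q} ?r"
    "vertex_label (local_structure s ?t q) = ?t" "root (local_structure s ?t q) = q"
    "order_rel (local_structure s ?t q) = leq \<inter> reach s {q} ?r \<times> reach s {q} ?r"
    if "q \<in> P" for q
    using reach_within_D[of "{q}" s ?r] that by (simp_all add: local_structure_def D_def Let_def)
  have arc: "(x, l, y) \<in> arcs (D s \<restriction> N) \<longleftrightarrow> edge s x l y \<and> x \<in> N \<and> y \<in> N" for x l y N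
    by (auto simp: edge_def D_def digraph_of_def)
  obtain f where bij: "bij_betw f ?N ?N'" and root: "f p = p'"
    and lab: "\<And>x. x \<in> ?N \<Longrightarrow> ?t (f x) = ?t x"
    and edg: "\<And>x y l. x \<in> ?N \<Longrightarrow> y \<in> ?N \<Longrightarrow> edge s x l y \<longleftrightarrow> edge s (f x) l (f y)"
    and ord: "\<And>x y. x \<in> ?N \<Longrightarrow> y \<in> ?N \<Longrightarrow> x \<sqsubseteq> y \<longleftrightarrow> f x \<sqsubseteq> f y"
  proof -
    obtain f where f: "bij_betw f ?N ?N'" "f p = p'" "\<forall>x\<in>?N. ?t (f x) = ?t x"
      "\<forall>x\<in>?N. \<forall>y\<in>?N. \<forall>l. (x, l, y) \<in> arcs (D s \<restriction> ?N) \<longleftrightarrow> (f x, l, f y) \<in> arcs (D s \<restriction> ?N')"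
      "\<forall>x\<in>?N. \<forall>y\<in>?N. (x, y) \<in> leq \<inter> ?N \<times> ?N \<longleftrightarrow> (f x, f y) \<in> leq \<inter> ?N' \<times> ?N'"
      using labeling_Suc_eqD[OF assms(1,2)] unfolding isomorphic_def str[OF assms(2)] str[OF assms(3)]
        induce_subgraph_verts by blast
    moreover have "f x \<in> ?N'" if "x \<in> ?N" for x
      using f(1) that by (auto simp: bij_betw_def)
    ultimately show thesis
      by (intro that[of f]) (auto simp: arc simp del: induce_subgraph_arcs)
  qed
  have f_in: "f x \<in> ?N'" if "x \<in> ?N" for x
    using bij that by (auto simp: bij_betw_def)
  have pair: "b \<in> reach s {p} k \<and> b' \<in> reach s {p'} k \<and> b' = f b"
    if "(b, b') \<in> par s {(p, p')} k" "k \<le> ?r" for k b b'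
    using that
  proof (induction k arbitrary: b b')
    case 0
    then show ?case using root by simp
  next
    case (Suc k)
    from Suc.prems(1) show ?case
    proof (cases rule: par_SucE)
      case old
      then show ?thesis using Suc.IH[of b b'] Suc.prems(2) by auto
    next
      case (step a a' l)
      then have a: "a \<in> reach s {p} k" "a' \<in> reach s {p'} k" "a' = f a"
        using Suc.IH Suc.prems(2) by auto
      have b: "b \<in> reach s {p} (Suc k)" "b' \<in> reach s {p'} (Suc k)"
        using reach_edge[OF a(1) step(2)] reach_edge[OF a(2) step(3)] by blast+
      then have N: "a \<in> ?N" "b \<in> ?N"
        using a(1) reach_mono[OF Suc.prems(2)] reach_mono[OF Suc_leD[OF Suc.prems(2)]] by blast+
      then have "edge s a' l (f b)" using edg step(2) a(3) by blast
      then have "f b = b'"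
        using edge_unique[OF _ step(3)] lab[OF N(2)] step(4) by simp
      then show ?thesis using b by blast
    qed
  qed
  have N: "a \<in> ?N" "a' = f a" if "(a, a') \<in> par s {(p, p')} k" "k \<le> ?r" for a a' k
    using pair[OF that] reach_mono[OF that(2)] by blast+
  show ?thesis
    unfolding sim_def
  proof (intro conjI allI impI)
    show "{(p, p')} \<subseteq> P \<times> P" using assms by simp
    show "?t a = ?t a'" if "(a, a') \<in> {(p, p')}" for a a'
      using that labeling_refines[OF assms(1,2)] by simp
    show "a \<sqsubseteq> b \<longleftrightarrow> a' \<sqsubseteq> b'"
      if "(a, a') \<in> par s {(p, p')} ?r" "(b, b') \<in> par s {(p, p')} ?r" for a a' b b'
      using N[OF that(1) order.refl] N[OF that(2) order.refl] ord by blast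
    show "forth s ?r {(p, p')}"
      unfolding forth_def
    proof (intro allI impI)
      fix k a a' l b
      assume k: "k < ?r" and a: "(a, a') \<in> par s {(p, p')} k" and e: "edge s a l b"
      have "b \<in> ?N" using pair[OF a less_imp_le[OF k]] reach_edge[OF _ e k] by blast
      then show "\<exists>b'. edge s a' l b' \<and> ?t b = ?t b'"
        using N[OF a less_imp_le[OF k]] edg e lab by metis
    qed
    show "forth s ?r ({(p, p')}\<inverse>)"
      unfolding forth_def
    proof (intro allI impI)
      fix k a' a l b'
      assume k: "k < ?r" and "(a', a) \<in> par s ({(p, p')}\<inverse>) k" and e: "edge s a' l b'"
      then have a: "(a, a') \<in> par s {(p, p')} k" by (simp only: par_converse converse_iff)
      have "b' \<in> ?N'" using pair[OF a less_imp_le[OF k]] reach_edge[OF _ e k] by blast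
      \<comment> \<open>Surjectivity of \<open>f\<close> provides the head for copying an arc from
        right to left.\<close>
      then obtain b where "b \<in> ?N" "b' = f b" using bij by (auto simp: bij_betw_def)
      then show "\<exists>b. edge s a l b \<and> ?t b' = ?t b"
        using N[OF a less_imp_le[OF k]] edg e lab by metis
    qed
  qed
qed

section \<open>Shifting an element within its chain\<close>

text \<open>From \<open>a'\<close> below \<open>a\<close>, the head \<open>q\<close> of an up arc
  from \<open>a\<close> is also a candidate for the up arc from \<open>a'\<close>, so the least
  candidate \<open>q'\<close> is below it. Down arcs are dual, and the heads of max and min arcs
  coincide.\<close>

lemma par_below:
  assumes "(q, q') \<in> par s {(p, p')} k" "p' \<sqsubseteq> p" "labeling s p = labeling s p'"
  shows "q' \<sqsubseteq> q \<and> labeling s q = labeling s q'"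
  using assms(1)
proof (induction k arbitrary: q q')
  case (Suc k)
  from Suc.prems show ?case
  proof (cases rule: par_SucE)
    case (step a a' l)
    then have a: "a' \<sqsubseteq> a" using Suc.IH by blast
    have "q' \<sqsubseteq> q"
    proof (cases l)
      case Up_arc
      have q: "a \<noteq> q" "a \<sqsubseteq> q" using step(2) Up_arc by (simp_all add: edge_Up_iff)
      then have "a' \<sqsubseteq> q" "q \<noteq> a'" using a le_trans le_antisym by blast+
      then show ?thesis using step(3)[unfolded Up_arc edge_Up_iff] step(4) by blast
    next
      case Down_arc
      have q: "a' \<noteq> q'" "q' \<sqsubseteq> a'" using step(3) Down_arc by (simp_all add: edge_Down_iff)
      then have "q' \<sqsubseteq> a" "q' \<noteq> a" using a le_trans le_antisym by blast+
      then show ?thesis using step(2)[unfolded Down_arc edge_Down_iff] step(4)[symmetric] by blast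
    qed (use edge_MaxMin_unique[OF step(2-4)] edge_in_P[OF step(2)] le_refl in auto)
    then show ?thesis using step(4) by blast
  qed (use Suc.IH in blast)
qed (use assms in auto)

text \<open>An element between the two ends of a pair of parallel walks is traced back to an element
  between the starting points.  Going back along an arc takes two steps, because one has to avoid
  the end of the interval from which the arc cannot be reversed.\<close>

lemma par_trace_back:
  assumes "p' \<sqsubseteq> p" "labeling (Suc s) p = labeling (Suc s) p'"
    and "(q, q') \<in> par s {(p, p')} k" "q \<noteq> q'"
    and "q' \<sqsubseteq> z" "z \<sqsubseteq> q" "labeling s z = labeling s q" "z \<in> reach (Suc s) A m"
  shows "\<exists>z0. p' \<sqsubseteq> z0 \<and> z0 \<sqsubseteq> p \<and> labeling (Suc s) z0 = labeling (Suc s) p \<and>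
    z0 \<in> reach (Suc s) A (Suc (m + 2 * k))"
  using assms(3-)
proof (induction k arbitrary: q q' z m)
  case 0
  then have z: "p' \<sqsubseteq> z" "z \<sqsubseteq> p" by auto
  show ?case
  proof (cases "z = p")
    case True
    then show ?thesis using 0 z by auto
  next
    case False
    \<comment> \<open>So far \<open>z\<close> only has the label of \<open>p\<close> at level
      \<open>s\<close>. One more arc reaches the label of level \<open>Suc s\<close>, which accounts
      for the outer \<open>Suc\<close> in the bound.\<close>
    then obtain z0 where z0: "edge (Suc s) z Up_arc z0" "labeling (Suc s) z0 = labeling (Suc s) p"
      "z0 \<sqsubseteq> p"
      using edge_Up_exists[OF z(2)] by blast
    have "p' \<sqsubseteq> z0" using z(1) z0(1) le_trans by (auto simp: edge_Up_iff)
    moreover have "z0 \<in> reach (Suc s) A (Suc (m + 2 * 0))"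
      using reach_edge[OF 0(6) z0(1) lessI] by simp
    ultimately show ?thesis using z0 by blast
  qed
next
  case (Suc k)
  note p_label = labeling_refines[OF assms(2) le_in_P(2)[OF assms(1)]]
  from Suc.prems(1) show ?case
  proof (cases rule: par_SucE)
    case old
    then show ?thesis
      using Suc.IH[OF old Suc.prems(2-)] reach_mono[of "Suc (m + 2 * k)" "Suc (m + 2 * Suc k)" "Suc s" A]
      by auto
  next
    case (step a a' l)
    have a: "a' \<sqsubseteq> a" "labeling s a = labeling s a'"
      using par_below[OF step(1) assms(1) p_label] by blast+
    have q: "q' \<sqsubseteq> q" using Suc.prems le_trans by blast
    have aP: "a \<in> P" using le_in_P a by blast
    have "a \<noteq> a'" using edge_unique[OF step(2) _ step(4)] step(3) Suc.prems(2) by blast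
    have "\<exists>z2. a' \<sqsubseteq> z2 \<and> z2 \<sqsubseteq> a \<and> labeling s z2 = labeling s a \<and> z2 \<in> reach (Suc s) A (Suc (Suc m))"
    proof (cases l)
      case Up_arc
      have up: "a \<noteq> q" "a \<sqsubseteq> q" "\<And>x. labeling s x = labeling s q \<Longrightarrow> x \<noteq> a \<Longrightarrow> a \<sqsubseteq> x \<Longrightarrow> q \<sqsubseteq> x"
        and up': "a' \<noteq> q'" "a' \<sqsubseteq> q'"
        using step(2,3)[unfolded Up_arc edge_Up_iff] by blast+
      \<comment> \<open>A down arc from \<open>q\<close> itself could end in the class of
        \<open>a\<close> above \<open>a\<close>. Starting strictly below \<open>q\<close> excludes
        this, since no member of the class of \<open>q\<close> lies strictly between
        \<open>a\<close> and \<open>q\<close>.\<close>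
      obtain z1 where z1: "q' \<sqsubseteq> z1" "z1 \<sqsubseteq> q" "z1 \<noteq> q" "labeling s z1 = labeling s q"
        "z1 \<in> reach (Suc s) A (Suc m)"
      proof (cases "z = q")
        case True
        obtain z1 where z1: "edge s q Down_arc z1" "labeling s z1 = labeling s q'" "q' \<sqsubseteq> z1"
          using edge_Down_exists[OF q] Suc.prems(2) by blast
        have "z1 \<in> reach (Suc s) A (Suc m)"
          using reach_edge[OF Suc.prems(6) _ lessI] edge_Suc[OF z1(1)] True by blast
        then show ?thesis
          using z1 step(4) by (intro that[of z1]) (auto simp: edge_Down_iff)
      next
        case False
        then show ?thesis using that[of z] Suc.prems by simp
      qed
      have "a' \<sqsubseteq> z1" "a' \<noteq> z1" using up' z1(1) le_trans le_antisym by blast+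
      then obtain z2 where z2: "edge s z1 Down_arc z2" "labeling s z2 = labeling s a'" "a' \<sqsubseteq> z2"
        using edge_Down_exists by blast
      then have z21: "z2 \<sqsubseteq> z1" "z2 \<noteq> z1" by (auto simp: edge_Down_iff)
      have "z2 \<sqsubseteq> a"
      proof (rule ccontr)
        assume "\<not> z2 \<sqsubseteq> a"
        then have "a \<sqsubseteq> z2" using same_label_comparable[of s z2 a] z2 a edge_in_P aP by metis
        then have "a \<sqsubseteq> z1" "z1 \<noteq> a" using z21 le_trans le_antisym by blast+
        then show False using up(3)[OF z1(4)] z1(2,3) le_antisym by blast
      qed
      moreover have "labeling s z2 = labeling s a" using z2(2) a(2) by simp
      ultimately show ?thesis
        using z2(3) reach_edge[OF z1(5) edge_Suc[OF z2(1)] lessI] by blast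
    next
      case Down_arc
      have dn: "a' \<noteq> q'" "q' \<sqsubseteq> a'"
          "\<And>x. labeling s x = labeling s q' \<Longrightarrow> x \<noteq> a' \<Longrightarrow> x \<sqsubseteq> a' \<Longrightarrow> x \<sqsubseteq> q'"
        and dn': "a \<noteq> q" "q \<sqsubseteq> a"
        using step(2,3)[unfolded Down_arc edge_Down_iff] by blast+
      \<comment> \<open>Dually, an up arc from \<open>q'\<close> could end below \<open>a'\<close>,
        so one starts strictly above \<open>q'\<close>.\<close>
      obtain z1 where z1: "q' \<sqsubseteq> z1" "z1 \<sqsubseteq> q" "z1 \<noteq> q'" "labeling s z1 = labeling s q'"
        "z1 \<in> reach (Suc s) A (Suc m)"
      proof (cases "z = q'")
        case True
        obtain z1 where z1: "edge s q' Up_arc z1" "labeling s z1 = labeling s q" "z1 \<sqsubseteq> q"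
          using edge_Up_exists[OF q] Suc.prems(2) by blast
        have "z1 \<in> reach (Suc s) A (Suc m)"
          using reach_edge[OF Suc.prems(6) _ lessI] edge_Suc[OF z1(1)] True by blast
        then show ?thesis
          using z1 step(4) by (intro that[of z1]) (auto simp: edge_Up_iff)
      next
        case False
        then show ?thesis using that[of z] Suc.prems step(4) by simp
      qed
      have "z1 \<sqsubseteq> a" "a \<noteq> z1" using dn' z1(2) le_trans le_antisym by blast+
      then obtain z2 where z2: "edge s z1 Up_arc z2" "labeling s z2 = labeling s a" "z2 \<sqsubseteq> a"
        using edge_Up_exists by blast
      then have z21: "z1 \<sqsubseteq> z2" "z2 \<noteq> z1" by (auto simp: edge_Up_iff)
      have "a' \<sqsubseteq> z2"
      proof (rule ccontr)
        assume "\<not> a' \<sqsubseteq> z2"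
        then have "z2 \<sqsubseteq> a'"
          using same_label_comparable[of s z2 a'] z2 a edge_in_P le_in_P by metis
        then have "z1 \<sqsubseteq> a'" "z1 \<noteq> a'" using z21 le_trans le_antisym by blast+
        then show False using dn(3)[OF z1(4)] z1(1,3) le_antisym by blast
      qed
      then show ?thesis
        using z2(2,3) reach_edge[OF z1(5) edge_Suc[OF z2(1)] lessI] by blast
    qed (use edge_MaxMin_unique[OF step(2-4)] Suc.prems(2) in auto)
    then obtain z2 where "a' \<sqsubseteq> z2" "z2 \<sqsubseteq> a" "labeling s z2 = labeling s a"
      "z2 \<in> reach (Suc s) A (Suc (Suc m))" by blast
    from Suc.IH[OF step(1) \<open>a \<noteq> a'\<close> this] show ?thesis by simp
  qed
qed

text \<open>If \<open>x\<close> is below \<open>q\<close> but not below \<open>q'\<close>, its up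
  arc into their class ends at most at \<open>q\<close>, and not below \<open>q'\<close>, hence
  inside the gap although \<open>R\<close> contains its head. The other case uses a down arc. The
  set \<open>R\<close> is kept abstract to cover both level 0 and higher levels.\<close>

lemma gap_order_agree:
  assumes le: "q' \<sqsubseteq> q" "labeling s q = labeling s q'"
    and x: "x \<in> R" "\<And>l z. edge s x l z \<Longrightarrow> z \<in> R"
    and gap: "\<And>z. q' \<sqsubseteq> z \<Longrightarrow> z \<sqsubseteq> q \<Longrightarrow> labeling s z = labeling s q \<Longrightarrow> z \<notin> R"
  shows "(x \<sqsubseteq> q \<longleftrightarrow> x \<sqsubseteq> q') \<and> (q \<sqsubseteq> x \<longleftrightarrow> q' \<sqsubseteq> x)"
proof -
  have "x \<sqsubseteq> q'" if below: "x \<sqsubseteq> q"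
  proof (rule ccontr)
    assume n: "\<not> x \<sqsubseteq> q'"
    \<comment> \<open>The ends of the interval belong to the gap too, whereas \<open>x\<close> lies
      in \<open>R\<close>.\<close>
    have "x \<noteq> q"
      using gap[OF le(1) le_refl[OF le_in_P(2)[OF le(1)]]] x(1) by blast
    then obtain z where z: "edge s x Up_arc z" "labeling s z = labeling s q" "z \<sqsubseteq> q"
      using edge_Up_exists[OF below] by blast
    then have "x \<sqsubseteq> z" by (simp add: edge_Up_iff)
    then have "\<not> z \<sqsubseteq> q'" using n le_trans by blast
    then have "q' \<sqsubseteq> z"
      using same_label_comparable[of s z q'] z(2) le edge_in_P(2)[OF z(1)] le_in_P(1) by auto
    then show False using gap[OF _ z(3,2)] x(2)[OF z(1)] by blast
  qed
  moreover have "q \<sqsubseteq> x" if above: "q' \<sqsubseteq> x"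
  proof (rule ccontr)
    assume n: "\<not> q \<sqsubseteq> x"
    have "x \<noteq> q'"
      using gap[OF le_refl[OF le_in_P(1)[OF le(1)]] le(1)] le(2) x(1) by auto
    then obtain z where z: "edge s x Down_arc z" "labeling s z = labeling s q'" "q' \<sqsubseteq> z"
      using edge_Down_exists[OF above] by blast
    then have "z \<sqsubseteq> x" by (simp add: edge_Down_iff)
    then have "\<not> q \<sqsubseteq> z" using n le_trans by blast
    then have "z \<sqsubseteq> q"
      using same_label_comparable[of s z q] z(2) le edge_in_P(2)[OF z(1)] le_in_P(2) by auto
    then show False using gap[OF z(3)] z(2) le(2) x(2)[OF z(1)] by auto
  qed
  ultimately show ?thesis using le(1) le_trans by blast
qed

text \<open>An element of the interval between \<open>q'\<close> and \<open>q\<close> within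
  \<open>Suc r\<close> steps of \<open>A\<close> could be traced back into the interval between
  \<open>p'\<close> and \<open>p\<close>, still within the range that \<open>gap\<close>
  excludes.\<close>

lemma par_order_agree:
  assumes p: "p' \<sqsubseteq> p" "labeling (Suc s) p = labeling (Suc s) p'"
    and gap: "\<And>z. p' \<sqsubseteq> z \<Longrightarrow> z \<sqsubseteq> p \<Longrightarrow> labeling (Suc s) z = labeling (Suc s) p \<Longrightarrow>
      z \<notin> reach (Suc s) A (3 * r + 2)"
    and x: "x \<in> reach s A r" and q: "(q, q') \<in> par s {(p, p')} r"
  shows "(x \<sqsubseteq> q \<longleftrightarrow> x \<sqsubseteq> q') \<and> (q \<sqsubseteq> x \<longleftrightarrow> q' \<sqsubseteq> x)"
proof (cases "q = q'")
  case False
  have le: "q' \<sqsubseteq> q" "labeling s q = labeling s q'"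
    using par_below[OF q p(1) labeling_refines[OF p(2) le_in_P(2)[OF p(1)]]] by blast+
  have x': "x \<in> reach (Suc s) A r" using x reach_Suc_level by blast
  show ?thesis
  proof (rule gap_order_agree[OF le])
    show "x \<in> reach (Suc s) A (Suc r)" using x' by simp
    show "z \<in> reach (Suc s) A (Suc r)" if "edge s x l z" for l z
      using reach_edge[OF x' edge_Suc[OF that] lessI] .
    show "z \<notin> reach (Suc s) A (Suc r)"
      if z: "q' \<sqsubseteq> z" "z \<sqsubseteq> q" "labeling s z = labeling s q" for z
    proof
      assume "z \<in> reach (Suc s) A (Suc r)"
      from par_trace_back[OF p q False z this] obtain z0 where z0: "p' \<sqsubseteq> z0" "z0 \<sqsubseteq> p"
        "labeling (Suc s) z0 = labeling (Suc s) p" "z0 \<in> reach (Suc s) A (Suc (Suc r + 2 * r))"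
        by blast
      have "Suc (Suc r + 2 * r) = 3 * r + 2" by simp
      then show False using gap[OF z0(1-3)] z0(4) by simp
    qed
  qed
qed simp

lemma nearby_twin:
  assumes "A \<subseteq> P" "A \<noteq> {}" "p \<in> P" "m > 0"
  obtains p' where "p' \<in> reach s A (Suc m)" "p' \<sqsubseteq> p" "labeling s p = labeling s p'"
    "p' = p \<or> (\<forall>z. p' \<sqsubseteq> z \<longrightarrow> z \<sqsubseteq> p \<longrightarrow> labeling s z = labeling s p \<longrightarrow> z \<notin> reach s A m)"
proof (cases "p \<in> reach s A m")
  case True
  then show ?thesis using that[of p] le_refl[OF assms(3)] by auto
next
  case False
  define S where "S = {z \<in> reach s A m. z \<sqsubseteq> p \<and> labeling s z = labeling s p}"
  show ?thesis
  proof (cases "S = {}")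
    case True
    obtain x where x: "x \<in> A" using assms(2) by blast
    \<comment> \<open>With no member of the class in range below \<open>p\<close>, the walk enters
      at the bottom of the chain of \<open>p\<close>. The absence of a closer member then already
      gives the gap.\<close>
    obtain b where b: "edge s x Min_arc b" "b \<sqsubseteq> p"
      using edge_Min_exists[of x p s] x assms by blast
    have b_reach: "b \<in> reach s A m" using reach_edge[OF _ b(1), of A 0 m] x assms(4) by simp
    then have "b \<noteq> p" using False by blast
    then obtain p' where p': "edge s b Up_arc p'" "labeling s p' = labeling s p" "p' \<sqsubseteq> p"
      using edge_Up_exists[OF b(2)] by blast
    have "p' \<in> reach s A (Suc m)" using reach_edge[OF b_reach p'(1) lessI] .
    then show ?thesis using that[of p'] p' True by (auto simp: S_def)
  next
    case nonempty: False
    have "finite S" by (rule finite_subset[OF _ finite_P]) (auto simp: S_def dest: le_in_P)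
    moreover have "y \<sqsubseteq> z \<or> z \<sqsubseteq> y" if "y \<in> S" "z \<in> S" for y z
      using same_label_comparable[of s y z] that le_in_P by (auto simp: S_def)
    ultimately obtain b where b: "topmost leq S b"
      using nonempty finite_chain_topmost[of S leq] partial_order_onD(2)[OF order] by meson
    then have b': "b \<in> reach s A m" "b \<sqsubseteq> p" "p \<noteq> b" using False by (auto simp: topmost_def S_def)
    then obtain p' where p': "edge s b Up_arc p'" "labeling s p' = labeling s p" "p' \<sqsubseteq> p"
      using edge_Up_exists[of b p] by blast
    have "p' \<in> reach s A (Suc m)" using reach_edge[OF b'(1) p'(1) lessI] .
    moreover have "z \<notin> reach s A m" if "p' \<sqsubseteq> z" "z \<sqsubseteq> p" "labeling s z = labeling s p" for z
    proof
      assume "z \<in> reach s A m"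
      then have "z \<sqsubseteq> b" using b that by (auto simp: topmost_def S_def)
      then have "p' \<sqsubseteq> b" using that(1) le_trans by blast
      then show False using p'(1) le_antisym by (auto simp: edge_Up_iff)
    qed
    ultimately show ?thesis using that[of p'] p' by simp
  qed
qed

section \<open>Local similarity determines the truth of formulas\<close>

text \<open>For \<open>q = Suc s\<close> this is \<open>3 * radius s + 3\<close>: \<open>radius s\<close> steps to an element that compares
  differently with the two walks, one into the interval between them, \<open>2 * radius s\<close> for tracing
  back, one to reach the label of level \<open>Suc s\<close>, and one from there to the twin.\<close>

definition choice_radius :: "nat \<Rightarrow> nat" where
  "choice_radius q = (if q = 0 then radius 0 else radius q - radius (q - 1))"

lemma choice_radius_Suc: "choice_radius (Suc s) = Suc (3 * radius s + 2)"
proof -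
  \<comment> \<open>Writing the power as a successor removes the truncation in the subtractions of
    \<open>radius\<close>.\<close>
  obtain n where "(4::nat) ^ s = Suc n" using gr0_implies_Suc[of "4 ^ s"] by auto
  then show ?thesis by (simp add: choice_radius_def radius_def)
qed

lemma radius_Suc: "radius (Suc s) = choice_radius (Suc s) + radius s"
proof -
  obtain n where "(4::nat) ^ s = Suc n" using gr0_implies_Suc[of "4 ^ s"] by auto
  then show ?thesis by (simp add: choice_radius_def radius_def)
qed

text \<open>The invariant for formulas of quantifier rank at most the index. Rank
  \<open>Suc s\<close> uses digraph level \<open>s\<close>, the level in which a choice below its
  outermost quantifier is measured.\<close>

primrec fo_sim :: "nat \<Rightarrow> 'a rel \<Rightarrow> bool" where
  "fo_sim 0 S = sim 0 0 S"
| "fo_sim (Suc s) S = sim s (radius s) S"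

lemma fo_sim_sim: "fo_sim q S \<Longrightarrow> \<exists>s r. sim s r S"
  by (cases q) auto

lemma fo_sim_subset: "fo_sim q T \<Longrightarrow> S \<subseteq> T \<Longrightarrow> fo_sim q S"
  by (cases q) (auto intro: sim_subset)

lemma fo_sim_converse: "fo_sim q S \<Longrightarrow> fo_sim q (S\<inverse>)"
  by (cases q) (auto intro: sim_converse)

lemma fo_sim_Id_on: "A \<subseteq> P \<Longrightarrow> fo_sim q (Id_on A)"
  by (cases q) (auto intro: sim_Id_on)

lemma fo_sim_order:
  assumes "fo_sim q S" "(a, a') \<in> S" "(b, b') \<in> S"
  shows "a \<sqsubseteq> b \<longleftrightarrow> a' \<sqsubseteq> b'"
  using fo_sim_sim[OF assms(1)] simD(3) assms(2,3) par_le[of 0] by fastforce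

lemma fo_sim_in_P:
  assumes "fo_sim q S" "(a, a') \<in> S"
  shows "a \<in> P" "a' \<in> P"
  using fo_sim_sim[OF assms(1)] simD(1) assms(2) by blast+

lemma fo_sim_color:
  assumes "fo_sim q S" "(a, a') \<in> S"
  shows "col a = col a'"
proof -
  obtain s r where "sim s r S" using fo_sim_sim[OF assms(1)] by blast
  then have "labeling 0 a = labeling 0 a'"
    using labeling_refines_Base simD(2) assms fo_sim_in_P by meson
  then show ?thesis by simp
qed

text \<open>Walking to \<open>c\<close> costs \<open>choice_radius q\<close>. For
  \<open>q = Suc s\<close>, \<open>radius_Suc\<close> leaves exactly \<open>radius s\<close>, and
  \<open>sim_lower\<close> drops the level to the one demanded by the smaller rank.\<close>

lemma fo_sim_extend:
  assumes "fo_sim (Suc q) S" "c \<in> reach q (Domain S) (choice_radius q)"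
  shows "\<exists>c'. fo_sim q (insert (c, c') S)"
proof -
  have "choice_radius q \<le> radius q" by (simp add: choice_radius_def)
  then obtain c' where c': "(c, c') \<in> par q S (choice_radius q)"
    using reach_imp_par[of q "radius q" S] assms by auto
  show ?thesis
  proof (cases q)
    case 0
    then show ?thesis
      using sim_insert_par[of 0 "radius 0" 0 S] assms(1) c' by (auto simp: choice_radius_def)
  next
    case (Suc s)
    then have "sim (Suc s) (choice_radius (Suc s) + radius s) S"
      using assms(1) radius_Suc by simp
    then show ?thesis
      using sim_insert_par sim_lower c' Suc by fastforce
  qed
qed

text \<open>By \<open>par_Un\<close> only comparisons between a walk from \<open>A\<close> and a
  walk from the new pair are open, and these are \<open>agree\<close>.\<close>

lemma sim_insert_Id_on:
  assumes A: "A \<subseteq> P" and p: "sim s r {(p, p')}"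
    and agree: "\<And>x q q'. x \<in> reach s A r \<Longrightarrow> (q, q') \<in> par s {(p, p')} r \<Longrightarrow>
      (x \<sqsubseteq> q \<longleftrightarrow> x \<sqsubseteq> q') \<and> (q \<sqsubseteq> x \<longleftrightarrow> q' \<sqsubseteq> x)"
  shows "sim s r (insert (p, p') (Id_on A))"
proof -
  note sims = p sim_Id_on[OF A, of s r]
  have eq: "insert (p, p') (Id_on A) = {(p, p')} \<union> Id_on A" by simp
  show ?thesis
    unfolding sim_def eq
  proof (intro conjI allI impI)
    show "{(p, p')} \<union> Id_on A \<subseteq> P \<times> P" using sims[THEN simD(1)] by blast
    show "labeling s a = labeling s a'" if "(a, a') \<in> {(p, p')} \<union> Id_on A" for a a'
      using that sims[THEN simD(2)] by blast
    show "a \<sqsubseteq> b \<longleftrightarrow> a' \<sqsubseteq> b'" if "(a, a') \<in> par s ({(p, p')} \<union> Id_on A) r"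
      "(b, b') \<in> par s ({(p, p')} \<union> Id_on A) r" for a a' b b'
    proof -
      have "(a, a') \<in> par s {(p, p')} r \<or> a = a' \<and> a \<in> reach s A r"
        "(b, b') \<in> par s {(p, p')} r \<or> b = b' \<and> b \<in> reach s A r"
        using that par_Id_on unfolding par_Un by blast+
      then show ?thesis using simD(3)[OF p] agree by blast
    qed
    show "forth s r ({(p, p')} \<union> Id_on A)"
      using forth_Un sims[THEN simD(4)] by blast
    show "forth s r (({(p, p')} \<union> Id_on A)\<inverse>)"
      unfolding converse_Un using forth_Un sims[THEN simD(5)] by blast
  qed
qed

text \<open>For \<open>q = Suc s\<close>, equal labels make the neighbourhoods similar at level
  \<open>s\<close>, and the gap left by \<open>nearby_twin\<close> makes their order towards
  \<open>A\<close> agree. At rank 0 only the elements themselves are compared.\<close>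

lemma local_twin:
  assumes A: "A \<subseteq> P" "A \<noteq> {}" and p: "p \<in> P"
  shows "\<exists>p'. p' \<in> reach q A (choice_radius q) \<and> fo_sim q (insert (p, p') (Id_on A))"
proof (cases q)
  case 0
  \<comment> \<open>The value \<open>radius 0 = 2\<close> is made up of one step for the gap and one
    from there to the twin.\<close>
  obtain p' where p': "p' \<in> reach 0 A 2" "p' \<sqsubseteq> p" "labeling 0 p = labeling 0 p'"
    and gap: "p' = p \<or> (\<forall>z. p' \<sqsubseteq> z \<longrightarrow> z \<sqsubseteq> p \<longrightarrow> labeling 0 z = labeling 0 p \<longrightarrow> z \<notin> reach 0 A 1)"
    using nearby_twin[OF A p, of 1 0] by (metis One_nat_def Suc_1 zero_less_one)
  have "sim 0 0 {(p, p')}"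
    using p p'(2,3) le_in_P le_refl by (auto simp: sim_def forth_def simp del: labeling.simps)
  moreover have "(x \<sqsubseteq> p \<longleftrightarrow> x \<sqsubseteq> p') \<and> (p \<sqsubseteq> x \<longleftrightarrow> p' \<sqsubseteq> x)" if x: "x \<in> A" for x
  proof (cases "p' = p")
    case False
    then have gap': "z \<notin> reach 0 A 1"
      if "p' \<sqsubseteq> z" "z \<sqsubseteq> p" "labeling 0 z = labeling 0 p" for z
      using gap that by blast
    show ?thesis
    proof (rule gap_order_agree[OF p'(2,3)])
      show "x \<in> reach 0 A 1" using x by simp
      show "z \<in> reach 0 A 1" if "edge 0 x l z" for l z
        using x that by auto
    qed (fact gap')
  qed simp
  ultimately have "sim 0 0 (insert (p, p') (Id_on A))"
    by (intro sim_insert_Id_on A(1)) auto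
  then show ?thesis using p'(1) 0 by (auto simp: choice_radius_def radius_def)
next
  case (Suc s)
  let ?r = "radius s"
  obtain p' where p': "p' \<in> reach (Suc s) A (Suc (3 * ?r + 2))" "p' \<sqsubseteq> p"
    "labeling (Suc s) p = labeling (Suc s) p'"
    and gap: "p' = p \<or> (\<forall>z. p' \<sqsubseteq> z \<longrightarrow> z \<sqsubseteq> p \<longrightarrow> labeling (Suc s) z = labeling (Suc s) p \<longrightarrow>
      z \<notin> reach (Suc s) A (3 * ?r + 2))"
    using nearby_twin[OF A p, of "3 * ?r + 2" "Suc s"] by (metis add_2_eq_Suc' zero_less_Suc)
  have sim: "sim s ?r {(p, p')}"
    using sim_of_same_label[OF p'(3) p] le_in_P(1)[OF p'(2)] by blast
  have "sim s ?r (insert (p, p') (Id_on A))"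
  proof (cases "p' = p")
    case True
    then have "insert (p, p') (Id_on A) = Id_on (insert p A)" by auto
    then show ?thesis using sim_Id_on[of "insert p A"] A p by auto
  next
    case False
    then show ?thesis using par_order_agree[OF p'(2,3)] gap by (intro sim_insert_Id_on A(1) sim) blast
  qed
  moreover have "p' \<in> reach (Suc s) A (choice_radius (Suc s))"
    using p'(1) unfolding choice_radius_Suc .
  ultimately show ?thesis using Suc by auto
qed

section \<open>Back and forth between two assignments\<close>

definition pairs :: "nat set \<Rightarrow> (nat \<rightharpoonup> 'a) \<Rightarrow> (nat \<rightharpoonup> 'a) \<Rightarrow> 'a rel" where
  "pairs V \<beta> \<beta>' = (\<lambda>x. (the (\<beta> x), the (\<beta>' x))) ` V"

lemma pairs_converse: "(pairs V \<beta> \<beta>')\<inverse> = pairs V \<beta>' \<beta>"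
  by (auto simp: pairs_def)

lemma pairs_mono: "V \<subseteq> W \<Longrightarrow> pairs V \<beta> \<beta>' \<subseteq> pairs W \<beta> \<beta>'"
  by (auto simp: pairs_def)

lemma pairs_update_subset:
  "pairs V (\<beta>(y \<mapsto> p)) (\<beta>'(y \<mapsto> p')) \<subseteq> insert (p, p') (pairs (V - {y}) \<beta> \<beta>')"
  by (auto simp: pairs_def)

lemma pairs_same: "pairs V \<beta> \<beta> = Id_on ((\<lambda>x. the (\<beta> x)) ` V)"
  by (auto simp: pairs_def)

text \<open>An arbitrary \<open>p\<close> may be too far from the tuple to be copied. It is first
  replaced by a nearby twin \<open>c\<close> over the same assignment, then \<open>c\<close> is
  copied to the other side. The two replacements are joined through the truth value of
  \<open>\<Phi>\<close>, so the relations themselves are never composed.\<close>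

lemma back_and_forth:
  assumes inv: "\<And>\<beta> \<beta>'. fo_sim q (pairs V \<beta> \<beta>') \<Longrightarrow> \<Phi> \<beta> \<longleftrightarrow> \<Phi> \<beta>'"
    and sim: "fo_sim (Suc q) (pairs (V - {y}) \<beta> \<beta>')" and p: "p \<in> P"
  shows "\<exists>p'\<in>P. \<Phi> (\<beta>(y \<mapsto> p)) \<longleftrightarrow> \<Phi> (\<beta>'(y \<mapsto> p'))"
proof (cases "V - {y} = {}")
  case True
  have "fo_sim q {(p, p)}" using fo_sim_Id_on[of "{p}" q] fo_sim_subset[of q "Id_on {p}"] p by blast
  then have "fo_sim q (pairs V (\<beta>(y \<mapsto> p)) (\<beta>'(y \<mapsto> p)))"
    using fo_sim_subset pairs_update_subset[of V \<beta> y p \<beta>' p] True by (simp add: pairs_def)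
  then show ?thesis using inv p by blast
next
  case False
  let ?S = "pairs (V - {y}) \<beta> \<beta>'" and ?A = "(\<lambda>x. the (\<beta> x)) ` (V - {y})"
  have dom: "Domain ?S = ?A" by (auto simp: pairs_def)
  then have "?A \<subseteq> P" using fo_sim_in_P[OF sim] by blast
  then obtain c where c: "c \<in> reach q ?A (choice_radius q)" "fo_sim q (insert (p, c) (Id_on ?A))"
    using local_twin[of ?A p q] False p by blast
  obtain c' where c': "fo_sim q (insert (c, c') ?S)"
    using fo_sim_extend[OF sim, of c] c(1) dom by auto
  have "\<Phi> (\<beta>(y \<mapsto> p)) \<longleftrightarrow> \<Phi> (\<beta>(y \<mapsto> c))"
    using inv fo_sim_subset[OF c(2)] pairs_update_subset[of V \<beta> y p \<beta> c] by (simp add: pairs_same)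
  moreover have "\<Phi> (\<beta>(y \<mapsto> c)) \<longleftrightarrow> \<Phi> (\<beta>'(y \<mapsto> c'))"
    by (rule inv[OF fo_sim_subset[OF c' pairs_update_subset]])
  ultimately show ?thesis using fo_sim_in_P(2)[OF c'] by blast
qed

text \<open>Each quantifier is treated by \<open>back_and_forth\<close>, once for the relation and
  once for its converse. The induction hypothesis for the body plays the role of
  \<open>inv\<close>.\<close>

lemma fo_sim_sat:
  assumes "quantifier_rank \<psi> \<le> q" "fo_sim q (pairs (free_vars \<psi>) \<beta> \<beta>')"
  shows "sat P leq col \<beta> \<psi> \<longleftrightarrow> sat P leq col \<beta>' \<psi>"
  using assms
proof (induction \<psi> arbitrary: q \<beta> \<beta>')
  case (Eq x y)
  \<comment> \<open>The invariant preserves the order, so equality is expressed through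
    antisymmetry.\<close>
  have eq_iff: "a = b \<longleftrightarrow> a \<sqsubseteq> b \<and> b \<sqsubseteq> a" if "a \<in> P" for a b
    using le_refl le_antisym that by blast
  have xy: "(the (\<beta> x), the (\<beta>' x)) \<in> pairs (free_vars (Eq x y)) \<beta> \<beta>'"
    "(the (\<beta> y), the (\<beta>' y)) \<in> pairs (free_vars (Eq x y)) \<beta> \<beta>'"
    by (simp_all add: pairs_def)
  note orders = fo_sim_order[OF Eq(2) xy] fo_sim_order[OF Eq(2) xy(2,1)]
  note in_P = fo_sim_in_P[OF Eq(2) xy(1)]
  show ?case
    unfolding sat.simps eq_iff[OF in_P(1)] eq_iff[OF in_P(2)] using orders by simp
next
  case (Leq x y)
  have "(the (\<beta> x), the (\<beta>' x)) \<in> pairs (free_vars (Leq x y)) \<beta> \<beta>'"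
    "(the (\<beta> y), the (\<beta>' y)) \<in> pairs (free_vars (Leq x y)) \<beta> \<beta>'"
    by (simp_all add: pairs_def)
  from fo_sim_order[OF Leq(2) this] show ?case by simp
next
  case (Col c x)
  then show ?case using fo_sim_color[OF Col(2)] by (simp add: pairs_def)
next
  case (Neg \<psi>)
  then show ?case by simp
next
  case (And \<psi> \<chi>)
  have "fo_sim q (pairs (free_vars \<psi>) \<beta> \<beta>')" "fo_sim q (pairs (free_vars \<chi>) \<beta> \<beta>')"
    by (rule fo_sim_subset[OF And.prems(2) pairs_mono], simp)+
  then show ?case using And.IH(1)[of q \<beta> \<beta>'] And.IH(2)[of q \<beta> \<beta>'] And.prems(1) by simp
next
  case (Or \<psi> \<chi>)
  have "fo_sim q (pairs (free_vars \<psi>) \<beta> \<beta>')" "fo_sim q (pairs (free_vars \<chi>) \<beta> \<beta>')"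
    by (rule fo_sim_subset[OF Or.prems(2) pairs_mono], simp)+
  then show ?case using Or.IH(1)[of q \<beta> \<beta>'] Or.IH(2)[of q \<beta> \<beta>'] Or.prems(1) by simp
next
  case (Ex y \<psi>)
  then obtain m where m: "q = Suc m" "quantifier_rank \<psi> \<le> m" by (cases q) auto
  note step = back_and_forth[where \<Phi> = "\<lambda>\<beta>. sat P leq col \<beta> \<psi>", OF Ex.IH[OF m(2)]]
  have S: "fo_sim (Suc m) (pairs (free_vars \<psi> - {y}) \<beta> \<beta>')" using Ex.prems(2) m(1) by simp
  then have "fo_sim (Suc m) (pairs (free_vars \<psi> - {y}) \<beta>' \<beta>)"
    using fo_sim_converse pairs_converse by metis
  from step[OF _ S] step[OF _ this] show ?case unfolding sat.simps by blast
next
  case (All y \<psi>)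
  then obtain m where m: "q = Suc m" "quantifier_rank \<psi> \<le> m" by (cases q) auto
  note step = back_and_forth[where \<Phi> = "\<lambda>\<beta>. sat P leq col \<beta> \<psi>", OF All.IH[OF m(2)]]
  have S: "fo_sim (Suc m) (pairs (free_vars \<psi> - {y}) \<beta> \<beta>')" using All.prems(2) m(1) by simp
  then have "fo_sim (Suc m) (pairs (free_vars \<psi> - {y}) \<beta>' \<beta>)"
    using fo_sim_converse pairs_converse by metis
  from step[OF _ S] step[OF _ this] show ?case unfolding sat.simps by blast
qed

section \<open>The choices offered by the local game\<close>

lemma local_choices_subset: "local_choices \<psi> \<beta> \<subseteq> P"
  by (auto simp: local_choices_def Let_def)

lemma local_choices_eq:
  assumes "ran \<beta> \<noteq> {}" "ran \<beta> \<subseteq> P" "q = quantifier_rank \<psi>"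
  shows "local_choices \<psi> \<beta> = reach q (ran \<beta>) (choice_radius q)"
  using assms reach_subset_P[OF assms(2)]
  by (auto simp: local_choices_def choice_radius_def reach_within_D Let_def)

text \<open>Both updates extend the same assignment, so the relation between them is an identity
  plus one pair, as supplied by \<open>local_twin\<close>. The equivalence serves both players: it
  transports witnesses as well as counterexamples.\<close>

lemma local_choices_suffice:
  assumes "dom \<beta> = free_vars \<psi> - {y}" "ran \<beta> \<subseteq> P" "p \<in> P"
  shows "\<exists>p'\<in>local_choices \<psi> \<beta>.
    sat P leq col (\<beta>(y \<mapsto> p)) \<psi> \<longleftrightarrow> sat P leq col (\<beta>(y \<mapsto> p')) \<psi>"
proof (cases "ran \<beta> = {}")
  case True
  then show ?thesis using assms(3) by (auto simp: local_choices_def)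
next
  case False
  define q where "q = quantifier_rank \<psi>"
  obtain p' where p': "p' \<in> reach q (ran \<beta>) (choice_radius q)"
    "fo_sim q (insert (p, p') (Id_on (ran \<beta>)))"
    using local_twin[OF assms(2) False assms(3)] by blast
  have "(\<lambda>x. the (\<beta> x)) ` (free_vars \<psi> - {y}) \<subseteq> ran \<beta>"
  proof
    fix a
    assume "a \<in> (\<lambda>x. the (\<beta> x)) ` (free_vars \<psi> - {y})"
    then obtain x where "x \<in> dom \<beta>" "a = the (\<beta> x)" unfolding assms(1)[symmetric] by blast
    then show "a \<in> ran \<beta>" by (auto intro: ranI)
  qed
  then have "pairs (free_vars \<psi>) (\<beta>(y \<mapsto> p)) (\<beta>(y \<mapsto> p')) \<subseteq> insert (p, p') (Id_on (ran \<beta>))"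
    using pairs_update_subset[of "free_vars \<psi>" \<beta> y p \<beta> p'] unfolding pairs_same by blast
  from fo_sim_subset[OF p'(2) this]
  have "sat P leq col (\<beta>(y \<mapsto> p)) \<psi> \<longleftrightarrow> sat P leq col (\<beta>(y \<mapsto> p')) \<psi>"
    using fo_sim_sat[of \<psi> q] q_def by blast
  then show ?thesis
    using p'(1) local_choices_eq[OF False assms(2) q_def] by blast
qed

end

section \<open>Games\<close>

lemma plays_snoc:
  assumes "\<pi> \<in> plays G" "(last \<pi>, y) \<in> moves G"
  shows "\<pi> @ [y] \<in> plays G"
  using assms by (auto simp: plays_def successively_append_iff)

lemma plays_butlast:
  assumes "\<pi> @ [y] \<in> plays G" "\<pi> \<noteq> []"
  shows "\<pi> \<in> plays G" "(last \<pi>, y) \<in> moves G"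
  using assms by (auto simp: plays_def successively_append_iff)

lemma conforms_snoc:
  assumes "\<pi> \<noteq> []"
  shows "conforms G \<sigma> (\<pi> @ [y]) \<longleftrightarrow> conforms G \<sigma> \<pi> \<and> (last \<pi> \<in> turn_E G \<longrightarrow> y = \<sigma> \<pi>)"
proof -
  obtain n where n: "length \<pi> = Suc n" using assms by (cases \<pi>) auto
  have "Suc i < length (\<pi> @ [y]) \<longleftrightarrow> Suc i < length \<pi> \<or> i = n" for i using n by auto
  then show ?thesis
    using n assms unfolding conforms_def by (auto simp: nth_append last_conv_nth)
qed

text \<open>The strategy looks only at the last position and picks a successor in \<open>W\<close>.
  Since winning is checked on each finite play separately, never leaving \<open>W\<close> is
  enough.\<close>

lemma winning_strategy_existsI:
  assumes start: "start G \<in> W"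
    and turn: "\<And>x. x \<in> W \<Longrightarrow> x \<in> turn_E G \<Longrightarrow> x \<in> Domain (moves G) \<Longrightarrow> \<exists>y\<in>W. (x, y) \<in> moves G"
    and other: "\<And>x y. x \<in> W \<Longrightarrow> x \<notin> turn_E G \<Longrightarrow> (x, y) \<in> moves G \<Longrightarrow> y \<in> W"
    and final: "\<And>x. x \<in> W \<Longrightarrow> x \<notin> Domain (moves G) \<Longrightarrow> x \<in> won_E G"
  shows "\<exists>\<sigma>. winning_strategy_E G \<sigma>"
proof
  define \<sigma> where "\<sigma> \<pi> = (SOME y. y \<in> W \<and> (last \<pi>, y) \<in> moves G)" for \<pi>
  have \<sigma>: "\<sigma> \<pi> \<in> W \<and> (last \<pi>, \<sigma> \<pi>) \<in> moves G"
    if "last \<pi> \<in> W" "last \<pi> \<in> turn_E G" "last \<pi> \<in> Domain (moves G)" for \<pi>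
    unfolding \<sigma>_def by (rule someI_ex) (use turn[OF that] in blast)
  have last_W: "last \<pi> \<in> W" if "\<pi> \<in> plays G" "conforms G \<sigma> \<pi>" for \<pi>
    using that
  proof (induction \<pi> rule: rev_induct)
    case Nil
    then show ?case by (simp add: plays_def)
  next
    case (snoc y \<pi>)
    show ?case
    proof (cases "\<pi> = []")
      case True
      then show ?thesis using snoc.prems start by (simp add: plays_def)
    next
      case False
      note p = plays_butlast[OF snoc.prems(1) False]
      have c: "conforms G \<sigma> \<pi>" "last \<pi> \<in> turn_E G \<Longrightarrow> y = \<sigma> \<pi>"
        using snoc.prems(2) conforms_snoc[OF False] by blast+
      have "last \<pi> \<in> W" using snoc.IH p(1) c(1) by blast
      then show ?thesis using \<sigma>[of \<pi>] other p(2) c(2) by fastforce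
    qed
  qed
  show "winning_strategy_E G \<sigma>"
    unfolding winning_strategy_E_def
    using last_W \<sigma> final by auto
qed

text \<open>Against a given strategy a conforming play is prolonged inside \<open>L\<close>. The
  measure \<open>f\<close> forces it to stop, and it then stops at a position outside
  \<open>won_E\<close>.\<close>

lemma no_winning_strategyI:
  fixes f :: "'p \<Rightarrow> nat"
  assumes start: "start G \<in> L"
    and turn: "\<And>x y. x \<in> L \<Longrightarrow> x \<in> turn_E G \<Longrightarrow> (x, y) \<in> moves G \<Longrightarrow> y \<in> L"
    and other: "\<And>x. x \<in> L \<Longrightarrow> x \<notin> turn_E G \<Longrightarrow> x \<in> Domain (moves G) \<Longrightarrow> \<exists>y\<in>L. (x, y) \<in> moves G"
    and final: "\<And>x. x \<in> L \<Longrightarrow> x \<notin> Domain (moves G) \<Longrightarrow> x \<notin> won_E G"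
    and decreasing: "\<And>x y. (x, y) \<in> moves G \<Longrightarrow> f y < f x"
  shows "\<not> winning_strategy_E G \<sigma>"
proof
  assume win: "winning_strategy_E G \<sigma>"
  have "False" if "\<pi> \<in> plays G" "conforms G \<sigma> \<pi>" "last \<pi> \<in> L" for \<pi>
    using that
  proof (induction "f (last \<pi>)" arbitrary: \<pi> rule: less_induct)
    case less
    have ne: "\<pi> \<noteq> []" using less.prems(1) by (simp add: plays_def)
    have w: "if last \<pi> \<in> Domain (moves G) then last \<pi> \<in> turn_E G \<longrightarrow> (last \<pi>, \<sigma> \<pi>) \<in> moves G
      else last \<pi> \<in> won_E G"
      using win less.prems unfolding winning_strategy_E_def by blast
    then have dom: "last \<pi> \<in> Domain (moves G)" using final[OF less.prems(3)] by presburger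
    have "\<exists>y\<in>L. (last \<pi>, y) \<in> moves G \<and> (last \<pi> \<in> turn_E G \<longrightarrow> y = \<sigma> \<pi>)"
    proof (cases "last \<pi> \<in> turn_E G")
      case True
      then have "(last \<pi>, \<sigma> \<pi>) \<in> moves G" using w dom by simp
      then show ?thesis using turn[OF less.prems(3) True] by blast
    next
      case False
      then show ?thesis using other[OF less.prems(3) False dom] by blast
    qed
    then obtain y where y: "y \<in> L" "(last \<pi>, y) \<in> moves G" "last \<pi> \<in> turn_E G \<longrightarrow> y = \<sigma> \<pi>"
      by blast
    show False
    proof (rule less.hyps)
      show "f (last (\<pi> @ [y])) < f (last \<pi>)" using decreasing[OF y(2)] by simp
      show "\<pi> @ [y] \<in> plays G" using plays_snoc[OF less.prems(1) y(2)] .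
      show "conforms G \<sigma> (\<pi> @ [y])" using conforms_snoc[OF ne] less.prems(2) y(3) by blast
      show "last (\<pi> @ [y]) \<in> L" using y(1) by simp
    qed
  qed
  moreover have "[start G] \<in> plays G" "conforms G \<sigma> [start G]"
    by (simp_all add: plays_def conforms_def)
  ultimately show False using start by fastforce
qed

section \<open>Positions and moves of Hintikka games\<close>

lemma sat_cong:
  "(\<And>x. x \<in> free_vars \<psi> \<Longrightarrow> \<beta> x = \<beta>' x) \<Longrightarrow> sat P leq col \<beta> \<psi> \<longleftrightarrow> sat P leq col \<beta>' \<psi>"
proof (induction \<psi> arbitrary: \<beta> \<beta>')
  case (Eq x y)
  from Eq[of x] Eq[of y] show ?case by simp
next
  case (Leq x y)
  from Leq[of x] Leq[of y] show ?case by simp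
next
  case (Col c x)
  from Col[of x] show ?case by simp
next
  case (Neg \<psi>)
  have "sat P leq col \<beta> \<psi> \<longleftrightarrow> sat P leq col \<beta>' \<psi>"
    by (rule Neg.IH, rule Neg.prems, simp)
  then show ?case by simp
next
  case (And \<psi> \<chi>)
  have "sat P leq col \<beta> \<psi> \<longleftrightarrow> sat P leq col \<beta>' \<psi>"
    by (rule And.IH(1), rule And.prems, simp)
  moreover have "sat P leq col \<beta> \<chi> \<longleftrightarrow> sat P leq col \<beta>' \<chi>"
    by (rule And.IH(2), rule And.prems, simp)
  ultimately show ?case by simp
next
  case (Or \<psi> \<chi>)
  have "sat P leq col \<beta> \<psi> \<longleftrightarrow> sat P leq col \<beta>' \<psi>"
    by (rule Or.IH(1), rule Or.prems, simp)
  moreover have "sat P leq col \<beta> \<chi> \<longleftrightarrow> sat P leq col \<beta>' \<chi>"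
    by (rule Or.IH(2), rule Or.prems, simp)
  ultimately show ?case by simp
next
  case (Ex y \<psi>)
  have "(\<beta>(y \<mapsto> p)) x = (\<beta>'(y \<mapsto> p)) x" if "x \<in> free_vars \<psi>" for p x
    using Ex.prems[of x] that by simp
  then have "sat P leq col (\<beta>(y \<mapsto> p)) \<psi> \<longleftrightarrow> sat P leq col (\<beta>'(y \<mapsto> p)) \<psi>" for p
    by (rule Ex.IH)
  then show ?case by simp
next
  case (All y \<psi>)
  have "(\<beta>(y \<mapsto> p)) x = (\<beta>'(y \<mapsto> p)) x" if "x \<in> free_vars \<psi>" for p x
    using All.prems[of x] that by simp
  then have "sat P leq col (\<beta>(y \<mapsto> p)) \<psi> \<longleftrightarrow> sat P leq col (\<beta>'(y \<mapsto> p)) \<psi>" for p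
    by (rule All.IH)
  then show ?case by simp
qed

lemma sat_restrict: "sat P leq col (\<beta> |` free_vars \<psi>) \<psi> \<longleftrightarrow> sat P leq col \<beta> \<psi>"
  by (rule sat_cong) simp

text \<open>The invariant of all plays. Negation normal form ensures that a play reaching a negation
  has reached a literal.\<close>

definition proper_positions :: "'a set \<Rightarrow> ('a, 'c) position set" where
  "proper_positions P = {(\<psi>, \<beta>). nnf \<psi> \<and> dom \<beta> = free_vars \<psi> \<and> ran \<beta> \<subseteq> P}"

inductive_simps hintikka_moves_pair_simps:
  "((And \<psi> \<chi>, \<beta>), (\<xi>, \<gamma>)) \<in> hintikka_moves choices"
  "((Or \<psi> \<chi>, \<beta>), (\<xi>, \<gamma>)) \<in> hintikka_moves choices"
  "((Ex x \<psi>, \<beta>), (\<xi>, \<gamma>)) \<in> hintikka_moves choices"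
  "((All x \<psi>, \<beta>), (\<xi>, \<gamma>)) \<in> hintikka_moves choices"
  "((Eq i j, \<beta>), (\<xi>, \<gamma>)) \<in> hintikka_moves choices"
  "((Leq i j, \<beta>), (\<xi>, \<gamma>)) \<in> hintikka_moves choices"
  "((Col c i, \<beta>), (\<xi>, \<gamma>)) \<in> hintikka_moves choices"
  "((Neg \<psi>, \<beta>), (\<xi>, \<gamma>)) \<in> hintikka_moves choices"

lemma hintikka_moves_simps:
  "((And \<psi> \<chi>, \<beta>), y) \<in> hintikka_moves choices \<longleftrightarrow>
     y = (\<psi>, \<beta> |` free_vars \<psi>) \<or> y = (\<chi>, \<beta> |` free_vars \<chi>)"
  "((Or \<psi> \<chi>, \<beta>), y) \<in> hintikka_moves choices \<longleftrightarrow>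
     y = (\<psi>, \<beta> |` free_vars \<psi>) \<or> y = (\<chi>, \<beta> |` free_vars \<chi>)"
  "((Ex x \<psi>, \<beta>), y) \<in> hintikka_moves choices \<longleftrightarrow>
     (\<exists>p\<in>choices \<psi> \<beta>. y = (\<psi>, \<beta>(x \<mapsto> p) |` free_vars \<psi>))"
  "((All x \<psi>, \<beta>), y) \<in> hintikka_moves choices \<longleftrightarrow>
     (\<exists>p\<in>choices \<psi> \<beta>. y = (\<psi>, \<beta>(x \<mapsto> p) |` free_vars \<psi>))"
  "((Eq i j, \<beta>), y) \<notin> hintikka_moves choices"
  "((Leq i j, \<beta>), y) \<notin> hintikka_moves choices"
  "((Col c i, \<beta>), y) \<notin> hintikka_moves choices"
  "((Neg \<psi>, \<beta>), y) \<notin> hintikka_moves choices"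
  by (cases y; simp only: hintikka_moves_pair_simps restrict_fun_upd prod.inject simp_thms; blast)+

lemma hintikka_moves_quantified:
  "(\<exists>y. ((Or \<psi> \<chi>, \<beta>), y) \<in> hintikka_moves choices \<and> Q y) \<longleftrightarrow>
     Q (\<psi>, \<beta> |` free_vars \<psi>) \<or> Q (\<chi>, \<beta> |` free_vars \<chi>)"
  "(\<exists>y. ((Ex x \<psi>, \<beta>), y) \<in> hintikka_moves choices \<and> Q y) \<longleftrightarrow>
     (\<exists>p\<in>choices \<psi> \<beta>. Q (\<psi>, \<beta>(x \<mapsto> p) |` free_vars \<psi>))"
  "(\<forall>y. ((And \<psi> \<chi>, \<beta>), y) \<in> hintikka_moves choices \<longrightarrow> Q y) \<longleftrightarrow>
     Q (\<psi>, \<beta> |` free_vars \<psi>) \<and> Q (\<chi>, \<beta> |` free_vars \<chi>)"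
  "(\<forall>y. ((All x \<psi>, \<beta>), y) \<in> hintikka_moves choices \<longrightarrow> Q y) \<longleftrightarrow>
     (\<forall>p\<in>choices \<psi> \<beta>. Q (\<psi>, \<beta>(x \<mapsto> p) |` free_vars \<psi>))"
  by (simp only: hintikka_moves_simps; blast)+

lemma hintikka_moves_size:
  assumes "(x, y) \<in> hintikka_moves choices"
  shows "size (fst y) < size (fst x)"
proof -
  obtain \<psi> \<beta> where "x = (\<psi>, \<beta>)" by (cases x)
  with assms show ?thesis by (cases \<psi>) (auto simp: hintikka_moves_simps simp del: restrict_fun_upd)
qed

lemma ran_restrict_subset: "ran (\<beta> |` V) \<subseteq> ran \<beta>"
  by (auto simp: ran_def restrict_map_def split: if_splits)

lemma proper_positions_restrict:
  assumes "nnf \<psi>" "free_vars \<psi> \<subseteq> dom \<beta>" "ran \<beta> \<subseteq> P"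
  shows "(\<psi>, \<beta> |` free_vars \<psi>) \<in> proper_positions P"
  using assms ran_restrict_subset[of \<beta> "free_vars \<psi>"] by (auto simp: proper_positions_def)

lemma ran_update_subset: "ran \<beta> \<subseteq> P \<Longrightarrow> p \<in> P \<Longrightarrow> ran (\<beta>(y \<mapsto> p)) \<subseteq> P"
  by (auto simp: ran_def)

lemma proper_positions_update:
  assumes "nnf \<psi>" "dom \<beta> = free_vars \<psi> - {y}" "ran \<beta> \<subseteq> P" "p \<in> P"
  shows "(\<psi>, \<beta>(y \<mapsto> p) |` free_vars \<psi>) \<in> proper_positions P"
proof (rule proper_positions_restrict)
  show "free_vars \<psi> \<subseteq> dom (\<beta>(y \<mapsto> p))" using assms(2) by auto
  show "ran (\<beta>(y \<mapsto> p)) \<subseteq> P" using ran_update_subset[OF assms(3,4)] .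
qed (fact assms(1))

lemma proper_positions_closed:
  assumes "(x, y) \<in> hintikka_moves choices" "x \<in> proper_positions P"
    and "\<And>\<psi> \<beta>. choices \<psi> \<beta> \<subseteq> P"
  shows "y \<in> proper_positions P"
proof -
  obtain \<psi> \<beta> where x: "x = (\<psi>, \<beta>)" by (cases x)
  then have "nnf \<psi>" "dom \<beta> = free_vars \<psi>" "ran \<beta> \<subseteq> P"
    using assms(2) by (auto simp: proper_positions_def)
  then show ?thesis
    using assms(1) subsetD[OF assms(3)] unfolding x
    by (cases \<psi>) (auto simp: hintikka_moves_simps simp del: restrict_fun_upd
        intro: proper_positions_restrict proper_positions_update)
qed

text \<open>If restricting quantifiers to \<open>choices\<close> does not change their truth, a
  position's truth value follows from its successors exactly as the rules of the game prescribe.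
  True positions then form a winning region and false ones a losing region.\<close>

lemma hintikka_game_with_correct:
  assumes "\<And>\<psi> \<beta>. choices \<psi> \<beta> \<subseteq> P"
    and suffice: "\<And>\<psi> y \<beta> p. dom \<beta> = free_vars \<psi> - {y} \<Longrightarrow> ran \<beta> \<subseteq> P \<Longrightarrow> p \<in> P \<Longrightarrow>
      \<exists>p'\<in>choices \<psi> \<beta>. sat P leq col (\<beta>(y \<mapsto> p)) \<psi> \<longleftrightarrow> sat P leq col (\<beta>(y \<mapsto> p')) \<psi>"
    and "nnf \<phi>" "free_vars \<phi> = {}"
  shows "(\<exists>\<sigma>. winning_strategy_E (hintikka_game_with choices P leq col \<phi>) \<sigma>) \<longleftrightarrow>
    models P leq col \<phi>"
proof -
  let ?G = "hintikka_game_with choices P leq col \<phi>"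
  let ?sat = "\<lambda>x. sat P leq col (snd x) (fst x)"
  let ?Q = "proper_positions P"
  have G: "start ?G = (\<phi>, Map.empty)" "moves ?G = hintikka_moves choices"
    by (simp_all add: hintikka_game_with_def)
  have start: "start ?G \<in> ?Q" "?sat (start ?G) \<longleftrightarrow> models P leq col \<phi>"
    using assms(3,4) by (simp_all add: G proper_positions_def models_def)
  have closed: "y \<in> ?Q" if "(x, y) \<in> moves ?G" "x \<in> ?Q" for x y
    using proper_positions_closed[OF _ that(2)] that(1) assms(1) G(2) by metis
  \<comment> \<open>Every element of \<open>P\<close> has a substitute among the choices with the
    same truth value, which settles both quantifiers at once.\<close>
  have quant: "(\<exists>p\<in>P. sat P leq col (\<beta>(y \<mapsto> p)) \<psi>) \<longleftrightarrow>
      (\<exists>p\<in>choices \<psi> \<beta>. sat P leq col (\<beta>(y \<mapsto> p)) \<psi>)"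
    "(\<forall>p\<in>P. sat P leq col (\<beta>(y \<mapsto> p)) \<psi>) \<longleftrightarrow>
      (\<forall>p\<in>choices \<psi> \<beta>. sat P leq col (\<beta>(y \<mapsto> p)) \<psi>)"
    if "dom \<beta> = free_vars \<psi> - {y}" "ran \<beta> \<subseteq> P" for \<psi> \<beta> y
    using suffice[OF that] assms(1) by (meson subsetD)+
  have turn: "?sat x \<longleftrightarrow> (\<exists>y. (x, y) \<in> moves ?G \<and> ?sat y)" if x: "x \<in> ?Q" "x \<in> turn_E ?G" for x
  proof -
    obtain \<psi> \<beta> where \<psi>: "x = (\<psi>, \<beta>)" by (cases x)
    show ?thesis
      using x unfolding \<psi> G(2)
      by (cases \<psi>) (auto simp: hintikka_game_with_def hintikka_moves_quantified sat_restrict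
          proper_positions_def quant Domain_iff hintikka_moves_simps(5-8)
          simp del: restrict_fun_upd split_paired_Ex split_paired_All)
  qed
  have other: "?sat x \<longleftrightarrow> (\<forall>y. (x, y) \<in> moves ?G \<longrightarrow> ?sat y)"
    if x: "x \<in> ?Q" "x \<notin> turn_E ?G" "x \<in> Domain (moves ?G)" for x
  proof -
    obtain \<psi> \<beta> where \<psi>: "x = (\<psi>, \<beta>)" by (cases x)
    show ?thesis
      using x unfolding \<psi> G(2)
      by (cases \<psi>) (auto simp: hintikka_game_with_def hintikka_moves_quantified sat_restrict
          proper_positions_def quant Domain_iff hintikka_moves_simps(5-8)
          simp del: restrict_fun_upd split_paired_Ex split_paired_All)
  qed
  \<comment> \<open>Besides literals, only quantifiers without choices are final. By
    \<open>quant\<close> these have the truth value of a quantifier over the empty set, in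
    accordance with \<open>won_E\<close>.\<close>
  have final: "x \<in> won_E ?G \<longleftrightarrow> ?sat x" if x: "x \<in> ?Q" "x \<notin> Domain (moves ?G)" for x
  proof -
    obtain \<psi> \<beta> where \<psi>: "x = (\<psi>, \<beta>)" by (cases x)
    show ?thesis
      using x unfolding \<psi> G(2)
      by (cases \<psi>) (auto simp: hintikka_game_with_def hintikka_moves_simps Domain_iff
          proper_positions_def quant is_literal_def)
  qed
  show ?thesis
  proof
    assume m: "models P leq col \<phi>"
    show "\<exists>\<sigma>. winning_strategy_E ?G \<sigma>"
      by (rule winning_strategy_existsI[where W = "{x \<in> ?Q. ?sat x}"])
        (use start m turn other final closed in blast)+
  next
    assume "\<exists>\<sigma>. winning_strategy_E ?G \<sigma>"
    then obtain \<sigma> where win: "winning_strategy_E ?G \<sigma>" ..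
    show "models P leq col \<phi>"
    proof (rule ccontr)
      assume m: "\<not> models P leq col \<phi>"
      have "\<not> winning_strategy_E ?G \<sigma>"
      proof (rule no_winning_strategyI[where L = "{x \<in> ?Q. \<not> ?sat x}" and f = "\<lambda>x. size (fst x)"])
        show "size (fst y) < size (fst x)" if "(x, y) \<in> moves ?G" for x y
          using hintikka_moves_size that G(2) by metis
      qed (use start m turn other final closed in blast)+
      then show False using win by blast
    qed
  qed
qed

theorem theorem4p4:
  fixes P :: "'a set"
    and leq :: "'a rel"
    and \<Lambda> :: "'c set"
    and col :: "'a \<Rightarrow> 'c"
    and w :: nat
    and C :: "nat \<Rightarrow> 'a set"
    and \<phi> :: "'c formula"
  assumes "chain_partitioned_poset P leq \<Lambda> col w C"
    and "free_vars \<phi> = {}"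
    and "colors_of \<phi> \<subseteq> \<Lambda>"
    and "nnf \<phi>"
  shows "(\<exists>\<sigma>. winning_strategy_E (chain_partitioned_poset.local_hintikka_game P leq col w C \<phi>) \<sigma>)
     \<longleftrightarrow> models P leq col \<phi>"
proof -
  interpret chain_partitioned_poset P leq \<Lambda> col w C
    by (fact assms(1))
  show ?thesis
    unfolding local_hintikka_game_def
    using local_choices_subset local_choices_suffice assms(4,2)
    by (rule hintikka_game_with_correct)
qed

end
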